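(* Let $A$ and $A'$ be matrices in $\mathbb{C}^{d\times d}$. Then the Horn matrix function $G_3(A,A';x,y)$ satisfies the following differential formulae, where $r$ is a positive integer: (1) $\dfrac{\partial^r}{\partial x^r}G_3(A,A';x,y)=(-1)^r(I-A)_r^{-1}\,G_3(A-rI,A'+2rI;x,y)\,(A')_{2r}$; (2) $\dfrac{\partial^r}{\partial y^r}G_3(A,A';x,y)=(-1)^r(A)_{2r}\,G_3(A+2rI,A'-rI;x,y)\,(I-A')_r^{-1}$; (3) $\Big(x^2\dfrac{\partial}{\partial x}\Big)^r\big[G_3(A,A';x^2,\tfrac{y}{x})\,x^{A'+(r-1)I}\big]=G_3(A,A'+rI;x^2,\tfrac{y}{x})\,x^{A'+rI}(A')_r$; (4) $\Big(y^2\dfrac{\partial}{\partial y}\Big)^r\big[y^{A+(r-1)I}G_3(A,A';\tfrac{x}{y},y^2)\big]=y^{A+rI}(A)_r\,G_3(A+rI,A';\tfrac{x}{y},y^2)$.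
   Context: $G_3(A,A';x,y)=\sum_{m,n=0}^{\infty}(A)_{2n-m}(A')_{2m-n}\frac{x^m y^n}{m!\,n!}$. Matrix Pochhammer symbol: for $M\in\mathbb{C}^{d\times d}$, $(M)_0=I$, $(M)_n=M(M+I)\cdots(M+(n-1)I)$ for $n\ge1$, and $(M)_{-n}=(-1)^n(I-M)_n^{-1}$; $(M)_n^{-1}$ is the inverse matrix of $(M)_n$. Matrix powers: $x^M=\exp(M\log x)$.
   Formalization: In (3), (4) the powers under the operators are corrected to x^{A'} and y^{A}, since the printed x^{A'+(r-1)I}, y^{A+(r-1)I} fail for r≥2 (d=1, y=0, r=2); each formula assumes the inverses in its Pochhammer symbols exist, on the domain of convergence, with principal log off its cut. *)

theory Defs
  imports "HOL-Analysis.Analysis"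
begin

text \<open>
  \<open>d \<times> d\<close> complex matrices are \<^typ>\<open>complex^'d^'d\<close>; \<open>kI\<close> is \<^term>\<open>mat k\<close>.
  The library scales matrices only by real numbers, so complex scaling is defined here.
\<close>

definition cscale :: "complex \<Rightarrow> complex^'d^'d \<Rightarrow> complex^'d^'d" where
  "cscale c M = map_matrix (\<lambda>a. c * a) M"

primrec mpow :: "complex^'d^'d \<Rightarrow> nat \<Rightarrow> complex^'d^'d" where
  "mpow M 0 = mat 1"
| "mpow M (Suc k) = mpow M k ** M"

definition mexp :: "complex^'d^'d \<Rightarrow> complex^'d^'d" where
  "mexp M = (\<Sum>k. cscale (1 / fact k) (mpow M k))"

text \<open>
  \<open>x\<^sup>M = exp (M log x)\<close> with the principal logarithm, hence analytic in \<open>x\<close> only off the cut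
  \<^term>\<open>\<real>\<^sub>\<le>\<^sub>0\<close>.
\<close>

definition mpowr :: "complex \<Rightarrow> complex^'d^'d \<Rightarrow> complex^'d^'d" where
  "mpowr x M = mexp (cscale (Ln x) M)"

primrec mpoch :: "complex^'d^'d \<Rightarrow> nat \<Rightarrow> complex^'d^'d" where
  "mpoch M 0 = mat 1"
| "mpoch M (Suc n) = mpoch M n ** (M + mat (of_nat n))"

definition mpoch_int :: "complex^'d^'d \<Rightarrow> int \<Rightarrow> complex^'d^'d" where
  "mpoch_int M k =
     (if k \<ge> 0 then mpoch M (nat k)
      else cscale ((-1) ^ nat (-k)) (matrix_inv (mpoch (mat 1 - M) (nat (-k)))))"

text \<open>
  All \<open>(M)\<^sub>k\<close>, \<open>k\<close> an integer, make sense: the inverses occurring in the negative-index symbols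
  exist. \<^const>\<open>matrix_inv\<close> is unspecified on singular matrices, so this condition is needed
  for each matrix that appears as a parameter of \<open>G\<^sub>3\<close>, where \<open>2n - m\<close> and \<open>2m - n\<close> run through
  all integers.
\<close>

definition mpoch_defined :: "complex^'d^'d \<Rightarrow> bool" where
  "mpoch_defined M \<longleftrightarrow> (\<forall>n. invertible (mpoch (mat 1 - M) n))"

definition G3_term ::
  "complex^'d^'d \<Rightarrow> complex^'d^'d \<Rightarrow> complex \<Rightarrow> complex \<Rightarrow> nat \<times> nat \<Rightarrow> complex^'d^'d" where
  "G3_term A A' x y = (\<lambda>(m, n).
     cscale (x ^ m * y ^ n / (fact m * fact n))
       (mpoch_int A (2 * int n - int m) ** mpoch_int A' (2 * int m - int n)))"

definition G3 ::
  "complex^'d^'d \<Rightarrow> complex^'d^'d \<Rightarrow> complex \<Rightarrow> complex \<Rightarrow> complex^'d^'d" where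
  "G3 A A' x y = (\<Sum>\<^sub>\<infinity>p\<in>UNIV. G3_term A A' x y p)"

text \<open>
  The domain of convergence of the double power series, in the usual sense of several complex
  variables: the interior of the set of points of absolute convergence.
\<close>

definition G3_dom :: "complex^'d^'d \<Rightarrow> complex^'d^'d \<Rightarrow> (complex \<times> complex) set" where
  "G3_dom A A' = interior {(x, y). (\<lambda>p. norm (G3_term A A' x y p)) summable_on UNIV}"

definition mholomorphic_on :: "(complex \<Rightarrow> complex^'d^'d) \<Rightarrow> complex set \<Rightarrow> bool" where
  "mholomorphic_on f S \<longleftrightarrow> (\<forall>i j. (\<lambda>z. f z $ i $ j) holomorphic_on S)"

text \<open>
  Entrywise complex derivative. As \<^const>\<open>deriv\<close> is total, differentiability has to be asserted
  separately, by \<^const>\<open>mholomorphic_on\<close> on an open set.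
\<close>

definition mderiv :: "(complex \<Rightarrow> complex^'d^'d) \<Rightarrow> complex \<Rightarrow> complex^'d^'d" where
  "mderiv f z = (\<chi> i j. deriv (\<lambda>w. f w $ i $ j) z)"

text \<open>
  The operator \<open>x\<^sup>2 d/dx\<close>. It satisfies \<open>(x\<^sup>2 d/dx)\<^sup>r x\<^sup>s = (s)\<^sub>r x\<^bsup>s + r\<^esup>\<close>. Erratum to the source:
  the two formulae with this operator are printed there with the powers \<open>x\<^bsup>A' + (r - 1)I\<^esup>\<close> and
  \<open>y\<^bsup>A + (r - 1)I\<^esup>\<close> under the operator. For \<open>r = 1\<close> these are \<open>x\<^bsup>A'\<^esup>\<close> and \<open>y\<^bsup>A\<^esup>\<close>, but for
  \<open>r \<ge> 2\<close> the printed formulae fail already for \<open>d = 1\<close>: the left-hand side starts with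
  exponent \<open>A' + 2r - 1\<close>, the right-hand side with \<open>A' + r\<close>. The powers that give the stated
  right-hand sides for every \<open>r\<close> are \<open>x\<^bsup>A'\<^esup>\<close> and \<open>y\<^bsup>A\<^esup>\<close>.
\<close>

definition sq_deriv :: "(complex \<Rightarrow> complex^'d^'d) \<Rightarrow> complex \<Rightarrow> complex^'d^'d" where
  "sq_deriv f = (\<lambda>z. cscale (z\<^sup>2) (mderiv f z))"

end

theory Submission
  imports Defs "HOL-Complex_Analysis.Cauchy_Integral_Formula"
begin

text \<open>
  Each formula is a termwise differentiation of the double series, followed by an identity between
  Pochhammer symbols and an iteration of the case \<open>r = 1\<close>.

  The identities come from \<open>(M)\<^sub>k (M + k I) = (M)\<^bsub>k+1\<^esub> = M (M + I)\<^sub>k\<close>, valid for all integers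
  \<open>k\<close> for which the symbols make sense (\<open>mpoch_int_plus_one\<close> and \<open>mpoch_int_shift\<close>). For the
  ordinary derivative in \<open>x\<close>, the index \<open>m\<close> moves up by one, so that \<open>2n - m\<close> drops by one and
  \<open>2m - n\<close> grows by two; the second identity turns this into a shift of \<open>A\<close> by \<open>-I\<close> and of
  \<open>A'\<close> by \<open>2I\<close>, at the price of constant factors on the left and on the right
  (\<open>G3_coeff_Suc\<close>). For \<open>x\<^sup>2 d/dx\<close>, a term of the substituted series times \<open>x\<^bsup>A'\<^esup>\<close> is a
  constant times \<open>x\<^bsup>A' + (2m - n) I\<^esup>\<close>; differentiation multiplies it by \<open>A' + (2m - n) I\<close>, and
  the two identities together turn this factor into the shift of \<open>A'\<close> by \<open>I\<close>
  (\<open>G3_coeff_plus_one\<close>).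

  On the analytic side, the domain of convergence is a union of open bidiscs of absolute convergence
  (\<open>interior_abs_conv_eq_conv_dom\<close>). On it the series, with holomorphic functions substituted for
  the variables, can be differentiated termwise (\<open>dps_has_mderiv\<close>). The series with shifted
  parameters converges there too, since its coefficients exceed the original ones at most by
  polynomial weights and index shifts (\<open>conv_dom_mono_weight\<close>, \<open>conv_dom_mono_shift\<close>); here
  the invertibility of \<open>A'\<close> and \<open>(A')\<^sub>2\<close> is used. This allows iteration on the domain of the
  original function.

  The formulae in \<open>y\<close> follow from those in \<open>x\<close> by transposition (\<open>G3_transpose\<close>), which
  exchanges the roles of \<open>A\<close> and \<open>A'\<close> and those of \<open>x\<close> and \<open>y\<close>.
\<close>


section \<open>Square complex matrices\<close>

lemma mat_plus_mat: "mat a + mat b = (mat (a + b) :: complex^'d^'d)"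
  by (simp add: mat_def vec_eq_iff)

lemma plus_mat_mat: "M + mat a + mat b = (M + mat (a + b) :: complex^'d^'d)"
  by (simp add: mat_plus_mat add.assoc)

lemma minus_mat_mat: "M - mat a - mat b = (M - mat (a + b) :: complex^'d^'d)"
  by (simp add: mat_def vec_eq_iff)

lemma matrix_add_rdistrib: "(M + N) ** P = M ** P + N ** (P :: complex^'d^'d)"
  by (simp add: vec_eq_iff matrix_matrix_mult_def sum.distrib algebra_simps)

lemma mat_mult_eq_cscale: "mat c ** M = cscale c M" "M ** mat c = cscale c M"
  by (simp_all add: mat_def cscale_def vec_eq_iff matrix_matrix_mult_def if_distrib if_distribR
      mult.commute cong: if_cong)

lemma cscale_simps [simp]:
  "cscale a (cscale b M) = cscale (a * b) M"
  "cscale a M ** N = cscale a (M ** N)"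
  "M ** cscale a N = cscale a (M ** N)"
  "cscale 1 M = M" "cscale 0 M = 0" "cscale a 0 = 0"
  "transpose (cscale a M) = cscale a (transpose M)"
  "cscale a M $ i $ j = a * M $ i $ j"
  by (simp_all add: cscale_def vec_eq_iff matrix_matrix_mult_def sum_distrib_left transpose_def
      algebra_simps)

lemma cscale_add_right: "cscale a (M + N) = cscale a M + cscale a N"
  and cscale_minus_one: "cscale (-1) M = - M"
  and cscale_uminus_right: "cscale a (- M) = cscale (- a) M"
  by (simp_all add: vec_eq_iff algebra_simps)

lemma matrix_mult_uminus:
  fixes M N :: "complex^'d^'d"
  shows "(- M) ** N = - (M ** N)" "M ** (- N) = - (M ** N)"
  by (simp_all add: vec_eq_iff matrix_matrix_mult_def sum_negf)

lemma norm_cscale: "norm (cscale c M) = norm c * norm M"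
proof -
  have "norm (cscale c M $ i) = norm c * norm (M $ i)" for i
    by (simp add: norm_vec_def L2_set_def norm_mult power_mult_distrib sum_distrib_left[symmetric]
        real_sqrt_mult)
  thus ?thesis
    by (simp add: norm_vec_def[of M] norm_vec_def[of "cscale c M"] L2_set_def power_mult_distrib
        sum_distrib_left[symmetric] real_sqrt_mult)
qed

lemma bounded_bilinear_matrix_mult:
  "bounded_bilinear (\<lambda>(M :: complex^'d^'d) (N :: complex^'d^'d). M ** N)"
proof -
  have "bilinear (\<lambda>(M :: complex^'d^'d) (N :: complex^'d^'d). M ** N)"
    unfolding bilinear_def
    by (auto intro!: linearI simp: matrix_add_ldistrib matrix_add_rdistrib
        matrix_scalar_ac scalar_matrix_assoc)
  thus ?thesis by (simp add: bilinear_conv_bounded_bilinear)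
qed

lemma norm_matrix_mult_le:
  "\<exists>K>0. \<forall>(M :: complex^'d^'d) (N :: complex^'d^'d). norm (M ** N) \<le> norm M * norm N * K"
  using bounded_bilinear.pos_bounded[OF bounded_bilinear_matrix_mult] by blast

lemma invertible_inv:
  assumes "invertible (M :: complex^'d^'d)"
  shows "M ** matrix_inv M = mat 1" "matrix_inv M ** M = mat 1"
  using assms someI_ex[of "\<lambda>N. M ** N = mat 1 \<and> N ** M = mat 1"]
  unfolding invertible_def matrix_inv_def by auto

lemma invertibleI:
  fixes M N :: "complex^'d^'d"
  assumes "M ** N = mat 1" shows "invertible M" "invertible N"
  using assms matrix_left_right_inverse[of M N] unfolding invertible_def by blast+

lemma matrix_inv_eqI:
  fixes M N :: "complex^'d^'d"
  assumes "M ** N = mat 1"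
  shows "matrix_inv M = N"
proof -
  have "matrix_inv M = matrix_inv M ** (M ** N)" by (simp add: assms)
  also have "\<dots> = N"
    using invertibleI(1)[OF assms] by (simp add: matrix_mul_assoc invertible_inv)
  finally show ?thesis .
qed

lemma matrix_inv_mult:
  fixes M N :: "complex^'d^'d"
  assumes "invertible M" "invertible N"
  shows "matrix_inv (M ** N) = matrix_inv N ** matrix_inv M"
proof (rule matrix_inv_eqI)
  have "M ** N ** (matrix_inv N ** matrix_inv M) = M ** (N ** matrix_inv N) ** matrix_inv M"
    by (simp add: matrix_mul_assoc)
  thus "M ** N ** (matrix_inv N ** matrix_inv M) = mat 1"
    by (simp add: invertible_inv assms)
qed

lemma matrix_inv_transpose:
  fixes M :: "complex^'d^'d"
  assumes "invertible M"
  shows "matrix_inv (transpose M) = transpose (matrix_inv M)"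
  by (rule matrix_inv_eqI) (simp flip: matrix_transpose_mul add: invertible_inv assms)

lemma invertible_multD:
  fixes M N :: "complex^'d^'d"
  assumes "invertible (M ** N)"
  shows "invertible M" "invertible N"
proof -
  have "M ** (N ** matrix_inv (M ** N)) = mat 1" "(matrix_inv (M ** N) ** M) ** N = mat 1"
    using invertible_inv[OF assms] by (simp_all add: matrix_mul_assoc)
  thus "invertible M" "invertible N" by (blast intro: invertibleI)+
qed

lemma invertible_uminus: "invertible (- M) \<longleftrightarrow> invertible (M :: complex^'d^'d)"
proof -
  have "invertible (- N)" if "invertible N" for N :: "complex^'d^'d"
    by (rule invertibleI(1)[of _ "- matrix_inv N"])
      (simp add: matrix_mult_uminus invertible_inv that)
  from this[of M] this[of "- M"] show ?thesis by auto
qed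

lemma cancel_invertible_right:
  fixes M N P :: "complex^'d^'d"
  assumes "M ** P = N ** P" "invertible P"
  shows "M = N"
proof -
  have "M ** P ** matrix_inv P = N ** P ** matrix_inv P" by (simp only: assms(1))
  thus ?thesis by (simp add: invertible_inv(1) assms(2) flip: matrix_mul_assoc)
qed

section \<open>The Pochhammer symbol with integer index\<close>

definition mcommute :: "complex^'d^'d \<Rightarrow> complex^'d^'d \<Rightarrow> bool" where
  "mcommute M N \<longleftrightarrow> M ** N = N ** M"

lemma mcommute_sym: "mcommute M N \<Longrightarrow> mcommute N M"
  by (simp add: mcommute_def)

lemma mcommute_refl: "mcommute M M"
  by (simp add: mcommute_def)

lemma mcommute_mat: "mcommute M (mat c)"
  by (simp add: mcommute_def mat_mult_eq_cscale)

lemma mcommute_add: "mcommute M N \<Longrightarrow> mcommute M P \<Longrightarrow> mcommute M (N + P)"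
  by (simp add: mcommute_def matrix_add_ldistrib matrix_add_rdistrib)

lemma mcommute_uminus: "mcommute M N \<Longrightarrow> mcommute M (- N)"
  by (simp add: mcommute_def matrix_mult_uminus)

lemma mcommute_diff: "mcommute M N \<Longrightarrow> mcommute M P \<Longrightarrow> mcommute M (N - P)"
  using mcommute_add[OF _ mcommute_uminus, of M N P] by simp

lemma mcommute_mult:
  assumes "mcommute M N" "mcommute M P" shows "mcommute M (N ** P)"
proof -
  have "M ** (N ** P) = N ** M ** P"
    using assms(1) by (simp add: mcommute_def matrix_mul_assoc)
  also have "\<dots> = N ** P ** M"
    using assms(2) by (simp add: mcommute_def flip: matrix_mul_assoc)
  finally show ?thesis by (simp add: mcommute_def)
qed

lemma mcommute_cscale: "mcommute M N \<Longrightarrow> mcommute M (cscale c N)"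
  by (simp add: mcommute_def)

lemma mcommute_inv:
  assumes "mcommute M N" "invertible N" shows "mcommute M (matrix_inv N)"
proof -
  let ?I = "matrix_inv N"
  have "?I ** M = ?I ** (M ** N) ** ?I"
    by (simp add: invertible_inv(1) assms(2) flip: matrix_mul_assoc)
  also have "M ** N = N ** M" using assms by (simp add: mcommute_def)
  also have "?I ** (N ** M) ** ?I = M ** ?I"
    by (simp add: matrix_mul_assoc invertible_inv assms(2))
  finally show ?thesis by (simp add: mcommute_def)
qed

lemma mcommute_mpoch: "mcommute M N \<Longrightarrow> mcommute M (mpoch N n)"
proof (induction n)
  case 0
  show ?case by (simp add: mcommute_mat)
next
  case (Suc n)
  thus ?case by (simp add: mcommute_mult mcommute_add mcommute_mat)
qed

lemma mcommute_shift_mpoch: "mcommute (M + mat c) (mpoch M n)"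
  by (rule mcommute_mpoch, rule mcommute_sym) (intro mcommute_add mcommute_refl mcommute_mat)

lemma mpoch_add: "mpoch M (m + n) = mpoch M m ** mpoch (M + mat (of_nat m)) n"
  by (induction n) (simp_all add: matrix_mul_assoc plus_mat_mat)

text \<open>
  Invertibility of all products \<open>(I - M)\<^sub>n\<close> is invertibility of each of their linear factors, so it
  says that no positive integer is an eigenvalue of \<open>M\<close>. The property is therefore inherited by
  \<open>M - k I\<close>, and passes from \<open>M + n I\<close> to \<open>M + m I\<close> for \<open>m \<le> n\<close>; the next lemmas say
  this. It is why one assumption on the last parameter of an iterated formula controls all
  intermediate ones.
\<close>

lemma mpoch_defined_factor:
  assumes "mpoch_defined M" shows "invertible (M - mat (of_nat (Suc i)))"
proof -
  have "invertible (mpoch (mat 1 - M) (Suc i))" using assms by (simp only: mpoch_defined_def)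
  hence "invertible (mat 1 - M + mat (of_nat i))" using invertible_multD(2) by auto
  moreover have "M - mat (of_nat (Suc i)) = - (mat 1 - M + mat (of_nat i))"
    by (simp add: mat_def vec_eq_iff)
  ultimately show ?thesis by (simp only: invertible_uminus)
qed

lemma mpoch_defined_minus:
  assumes "mpoch_defined M" shows "mpoch_defined (M - mat (of_nat k))"
  unfolding mpoch_defined_def
proof
  fix n
  have "invertible (mpoch (mat 1 - M) (k + n))"
    using assms by (simp only: mpoch_defined_def)
  hence "invertible (mpoch (mat 1 - M + mat (of_nat k)) n)"
    unfolding mpoch_add by (rule invertible_multD)
  thus "invertible (mpoch (mat 1 - (M - mat (of_nat k))) n)"
    by (simp add: algebra_simps)
qed

lemma mpoch_defined_plus_mono:
  assumes "mpoch_defined (M + mat (of_nat n))" "m \<le> n"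
  shows "mpoch_defined (M + mat (of_nat m))"
proof -
  have "M + mat (of_nat m) = M + mat (of_nat n) - mat (of_nat (n - m))"
    using assms(2) by (simp add: mat_def vec_eq_iff of_nat_diff)
  thus ?thesis using mpoch_defined_minus[OF assms(1)] by metis
qed

lemma mpoch_int_of_nat: "mpoch_int M (int n) = mpoch M n"
  by (simp add: mpoch_int_def)

lemma mpoch_int_uminus_of_nat:
  fixes M :: "complex^'d^'d"
  shows "mpoch_int M (- int n) = cscale ((-1) ^ n) (matrix_inv (mpoch (mat 1 - M) n))"
proof (cases "n = 0")
  case True
  have "matrix_inv (mat 1) = (mat 1 :: complex^'d^'d)" by (rule matrix_inv_eqI) simp
  thus ?thesis using True by (simp add: mpoch_int_def)
qed (simp add: mpoch_int_def)

text \<open>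
  With the convention for negative indices, the recursion of the Pochhammer symbol extends to all
  integers: for \<open>k < 0\<close> the factor \<open>M + k I\<close> is, up to sign, the last factor of
  \<open>(I - M)\<^bsub>-k\<^esub>\<close> and cancels it from the inverse.
\<close>

lemma mpoch_int_plus_one:
  assumes M: "mpoch_defined M"
  shows "mpoch_int M (k + 1) = mpoch_int M k ** (M + mat (of_int k))"
proof (cases "k \<ge> 0")
  case True
  then obtain n where k: "k = int n" using nonneg_int_cases by blast
  have "k + 1 = int (Suc n)" by (simp add: k)
  hence "mpoch_int M (k + 1) = mpoch M (Suc n)" by (simp only: mpoch_int_of_nat)
  thus ?thesis by (simp add: k mpoch_int_of_nat)
next
  case False
  define n where "n = nat (- k - 1)"
  have k: "k = - int (Suc n)" "k + 1 = - int n" using False by (auto simp: n_def)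
  define P where "P = mpoch (mat 1 - M) n"
  define Q where "Q = mat 1 - M + mat (of_nat n)"
  have *: "mpoch (mat 1 - M) (Suc n) = P ** Q" by (simp add: P_def Q_def)
  have inv: "invertible (P ** Q)" "invertible P" "invertible Q"
    using M * invertible_multD[of P Q] unfolding mpoch_defined_def by metis+
  have "mcommute Q P" unfolding P_def Q_def by (rule mcommute_shift_mpoch)
  hence inv_PQ: "matrix_inv (P ** Q) = matrix_inv P ** matrix_inv Q"
    using inv by (metis matrix_inv_mult mcommute_def)
  have Q: "M + mat (of_int k) = cscale (-1) Q"
    by (simp add: k Q_def mat_def vec_eq_iff algebra_simps)
  have "matrix_inv P ** matrix_inv Q ** Q = matrix_inv P"
    by (simp add: invertible_inv inv flip: matrix_mul_assoc)
  thus ?thesis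
    unfolding k(2) unfolding k(1) mpoch_int_uminus_of_nat * inv_PQ
    unfolding Q[unfolded k(1)] by (simp add: P_def)
qed

text \<open>
  The first factor can be split off instead of the last one. Both sides satisfy the recursion in
  \<open>k\<close> above, which determines the sequence upwards from \<open>k = 0\<close>, and also downwards because
  \<open>M + k I\<close> is invertible for \<open>k \<le> 0\<close>. For \<open>k = 0\<close> that invertibility comes from the
  assumption on \<open>M + I\<close>, for \<open>k < 0\<close> from the one on \<open>M\<close>. All parameter shifts of \<open>G\<^sub>3\<close>
  rest on this identity.
\<close>

lemma mpoch_int_shift:
  assumes M: "mpoch_defined M" and M1: "mpoch_defined (M + mat 1)"
  shows "M ** mpoch_int (M + mat 1) k = mpoch_int M (k + 1)"
proof (induction k rule: int_induct[where k = 0])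
  case base
  have 0: "mpoch_int N 0 = mat 1" for N :: "complex^'d^'d" by (simp add: mpoch_int_def)
  show ?case using mpoch_int_plus_one[OF M, of 0] by (simp add: 0)
next
  case (step1 i)
  have e: "M + mat 1 + mat (of_int i) = M + mat (of_int (i + 1))"
    by (simp add: mat_plus_mat add.commute add.left_commute)
  show ?case
    unfolding mpoch_int_plus_one[OF M1, of i] matrix_mul_assoc step1 e
    by (rule mpoch_int_plus_one[OF M, of "i + 1", symmetric])
next
  case (step2 i)
  have e: "M + mat 1 + mat (of_int (i - 1)) = M + mat (of_int i)"
    by (simp add: mat_def vec_eq_iff)
  have inv: "invertible (M + mat (of_int i))"
  proof (cases "i = 0")
    case True
    thus ?thesis using mpoch_defined_factor[OF M1, of 0] by simp
  next
    case False
    define n where "n = nat (- i) - 1"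
    have i: "i = - int (Suc n)" using False step2 by (auto simp: n_def)
    have "M + mat (of_int i) = M - mat (of_nat (Suc n))"
      by (simp add: i mat_def vec_eq_iff)
    thus ?thesis using mpoch_defined_factor[OF M] by metis
  qed
  have "M ** mpoch_int (M + mat 1) (i - 1) ** (M + mat (of_int i))
      = M ** mpoch_int (M + mat 1) (i - 1 + 1)"
    unfolding mpoch_int_plus_one[OF M1] e matrix_mul_assoc ..
  also have "\<dots> = mpoch_int M i ** (M + mat (of_int i))"
    using step2 mpoch_int_plus_one[OF M] by simp
  finally show ?case using cancel_invertible_right[OF _ inv] by simp
qed

lemma mcommute_mpoch_int:
  assumes "mcommute N M" "mpoch_defined M"
  shows "mcommute N (mpoch_int M k)"
  using assms unfolding mpoch_int_def mpoch_defined_def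
  by (auto intro!: mcommute_mpoch mcommute_cscale mcommute_inv mcommute_diff mcommute_mat)

lemma transpose_add: "transpose (M + N) = transpose M + transpose (N :: complex^'d^'d)"
  and transpose_diff: "transpose (M - N) = transpose M - transpose (N :: complex^'d^'d)"
  by (simp_all add: transpose_def vec_eq_iff)

lemma transpose_mpoch: "transpose (mpoch M n) = mpoch (transpose M) n"
proof (induction n)
  case (Suc n)
  have "mcommute (M + mat (of_nat n)) (mpoch M n)"
    by (rule mcommute_shift_mpoch)
  hence "transpose (mpoch M (Suc n)) = transpose ((M + mat (of_nat n)) ** mpoch M n)"
    by (simp add: mcommute_def)
  thus ?case by (simp add: matrix_transpose_mul transpose_add Suc)
qed simp

lemma invertible_transpose: "invertible (transpose M) \<longleftrightarrow> invertible (M :: complex^'d^'d)"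
proof -
  have "invertible (transpose N)" if "invertible N" for N :: "complex^'d^'d"
    by (rule invertibleI(1)[of _ "transpose (matrix_inv N)"])
      (simp add: invertible_inv that flip: matrix_transpose_mul)
  from this[of M] this[of "transpose M"] show ?thesis by auto
qed

lemma mpoch_defined_transpose: "mpoch_defined (transpose M) \<longleftrightarrow> mpoch_defined M"
proof -
  have "mpoch (mat 1 - transpose M) n = transpose (mpoch (mat 1 - M) n)" for n
    by (simp add: transpose_mpoch transpose_diff)
  thus ?thesis by (simp add: mpoch_defined_def invertible_transpose)
qed

lemma transpose_mpoch_int:
  assumes "mpoch_defined M"
  shows "transpose (mpoch_int M k) = mpoch_int (transpose M) k"
  using assms unfolding mpoch_int_def mpoch_defined_def
  by (auto simp: transpose_mpoch transpose_diff matrix_inv_transpose[symmetric])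


section \<open>Entrywise complex differentiation\<close>

text \<open>
  A relational companion of \<^const>\<open>mderiv\<close> that includes differentiability, so that one fact
  yields both the holomorphy and the value of the derivative.
\<close>

definition has_mderiv :: "(complex \<Rightarrow> complex^'d^'d) \<Rightarrow> complex^'d^'d \<Rightarrow> complex \<Rightarrow> bool" where
  "has_mderiv f D z \<longleftrightarrow>
     (\<forall>i j. ((\<lambda>w. f w $ i $ j) has_field_derivative D $ i $ j) (at z))"

lemma mderiv_eqI: "has_mderiv f D z \<Longrightarrow> mderiv f z = D"
  by (simp add: has_mderiv_def mderiv_def vec_eq_iff DERIV_imp_deriv)

lemma mholomorphic_onI:
  assumes "\<And>z. z \<in> S \<Longrightarrow> has_mderiv f (D z) z"
  shows "mholomorphic_on f S"
  unfolding mholomorphic_on_def holomorphic_on_def field_differentiable_def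
  using assms unfolding has_mderiv_def by (blast intro: has_field_derivative_at_within)

lemma mderiv_cong:
  assumes "open S" "z \<in> S" "\<And>w. w \<in> S \<Longrightarrow> f w = g w"
  shows "mderiv f z = mderiv g z"
proof -
  have "eventually (\<lambda>w. w \<in> S) (nhds z)" using assms(1,2) by (rule eventually_nhds_in_open)
  hence "eventually (\<lambda>w. f w $ i $ j = g w $ i $ j) (nhds z)" for i j
    by eventually_elim (simp add: assms(3))
  thus ?thesis unfolding mderiv_def vec_eq_iff by (auto intro: deriv_cong_ev)
qed

lemma has_mderiv_const: "has_mderiv (\<lambda>w. M) 0 z"
  by (simp add: has_mderiv_def)

lemma has_mderiv_mult:
  assumes "has_mderiv f D z" "has_mderiv g E z"
  shows "has_mderiv (\<lambda>w. f w ** g w) (D ** g z + f z ** E) z"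
  using assms unfolding has_mderiv_def matrix_matrix_mult_def
  by (auto intro!: derivative_eq_intros simp: sum.distrib add.commute mult.commute)

lemma has_mderiv_mult_const:
  fixes M N :: "complex^'d^'d"
  assumes "has_mderiv f D z"
  shows "has_mderiv (\<lambda>w. M ** f w ** N) (M ** D ** N) z"
  using has_mderiv_mult[OF has_mderiv_mult[OF has_mderiv_const[of M] assms] has_mderiv_const[of N]]
  by simp

lemma has_mderiv_cscale:
  assumes "(h has_field_derivative h') (at z)" "has_mderiv f D z"
  shows "has_mderiv (\<lambda>w. cscale (h w) (f w)) (cscale h' (f z) + cscale (h z) D) z"
  using assms unfolding has_mderiv_def
  by (auto intro!: derivative_eq_intros simp: algebra_simps)

lemma has_mderiv_chain:
  assumes "has_mderiv f D (h z)" "(h has_field_derivative h') (at z)"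
  shows "has_mderiv (\<lambda>w. f (h w)) (cscale h' D) z"
  using assms DERIV_chain2[of "\<lambda>w. f w $ i $ j" "D $ i $ j" h z h' UNIV for i j]
  unfolding has_mderiv_def by (auto simp: mult.commute)

lemma has_mderiv_zero_const:
  assumes "\<And>z. has_mderiv f 0 z"
  shows "f w = f 0"
proof -
  have "f w $ i $ j = f 0 $ i $ j" for i j
    using assms[unfolded has_mderiv_def]
      has_field_derivative_zero_constant[of UNIV "\<lambda>w. f w $ i $ j"] by auto
  thus ?thesis by (simp add: vec_eq_iff)
qed

section \<open>The matrix exponential and matrix powers\<close>

lemma mpow_cscale: "mpow (cscale w M) k = cscale (w ^ k) (mpow M k)"
  by (induction k) simp_all

lemma norm_mpow_le:
  fixes M :: "complex^'d^'d"
  assumes K: "\<And>(M :: complex^'d^'d) (N :: complex^'d^'d). norm (M ** N) \<le> norm M * norm N * K"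
  shows "norm (mpow M k) \<le> norm (mat 1 :: complex^'d^'d) * (norm M * \<bar>K\<bar>) ^ k"
proof (induction k)
  case (Suc k)
  have "norm (mpow M (Suc k)) \<le> norm (mpow M k) * norm M * K" using K[of "mpow M k" M] by simp
  also have "\<dots> \<le> norm (mpow M k) * (norm M * \<bar>K\<bar>)"
    by (simp add: mult_left_mono mult.assoc)
  also have "\<dots> \<le> norm (mat 1 :: complex^'d^'d) * (norm M * \<bar>K\<bar>) ^ k * (norm M * \<bar>K\<bar>)"
    by (intro mult_right_mono Suc) auto
  finally show ?case by (simp add: mult_ac)
qed simp

lemma mexp_sums:
  fixes M :: "complex^'d^'d"
  shows "(\<lambda>k. cscale (w ^ k / fact k) (mpow M k)) sums mexp (cscale w M)"
proof -
  obtain K where K: "\<And>(M :: complex^'d^'d) (N :: complex^'d^'d). norm (M ** N) \<le> norm M * norm N * K"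
    using norm_matrix_mult_le by blast
  let ?N = "cscale w M"
  have "summable (\<lambda>k. norm (mat 1 :: complex^'d^'d) * (inverse (fact k) * (norm ?N * \<bar>K\<bar>) ^ k))"
    by (intro summable_mult summable_exp)
  moreover have "norm (cscale (1 / fact k) (mpow ?N k))
      \<le> norm (mat 1 :: complex^'d^'d) * (inverse (fact k) * (norm ?N * \<bar>K\<bar>) ^ k)" for k
    using mult_left_mono[OF norm_mpow_le[OF K, of ?N k], of "inverse (fact k)"]
    by (simp add: norm_cscale norm_inverse divide_inverse mult_ac)
  ultimately have "summable (\<lambda>k. cscale (1 / fact k) (mpow ?N k))"
    by (rule summable_comparison_test'[where N = 0])
  thus ?thesis unfolding mexp_def by (simp add: summable_sums mpow_cscale)
qed

lemma mexp_0: "mexp 0 = (mat 1 :: complex^'d^'d)"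
proof -
  have "(\<lambda>k. cscale (0 ^ k / fact k) (mpow 0 k)) sums cscale (0 ^ 0 / fact 0) (mpow 0 0 :: complex^'d^'d)"
    using sums_finite[of "{0}" "\<lambda>k. cscale (0 ^ k / fact k) (mpow 0 k) :: complex^'d^'d"]
    by (simp add: power_0_left)
  from sums_unique2[OF this mexp_sums[of 0 0]] show ?thesis by simp
qed

lemma mcommute_mexp:
  assumes "mcommute N M" shows "mcommute N (mexp M)"
proof -
  have pow: "mcommute N (mpow M k)" for k
    by (induction k) (simp_all add: mcommute_mat mcommute_mult assms)
  note s = mexp_sums[of 1 M, simplified]
  have "(\<lambda>k. N ** cscale (1 / fact k) (mpow M k)) sums (N ** mexp M)"
    by (rule bounded_linear.sums[OF bounded_bilinear.bounded_linear_right[OF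
          bounded_bilinear_matrix_mult] s])
  moreover have "(\<lambda>k. cscale (1 / fact k) (mpow M k) ** N) sums (mexp M ** N)"
    by (rule bounded_linear.sums[OF bounded_bilinear.bounded_linear_left[OF
          bounded_bilinear_matrix_mult] s])
  moreover have "N ** cscale c (mpow M k) = cscale c (mpow M k) ** N" for c k
    using mcommute_cscale[OF pow[of k], of c] by (simp only: mcommute_def)
  ultimately show ?thesis unfolding mcommute_def by (simp only: sums_unique2)
qed

lemma bounded_linear_entry: "bounded_linear (\<lambda>M :: complex^'d^'d. M $ i $ j)"
  by (intro bounded_linear_compose[OF bounded_linear_vec_nth bounded_linear_vec_nth])

lemma has_mderiv_mexp: "has_mderiv (\<lambda>w. mexp (cscale w M)) (mexp (cscale w M) ** M) w"
  unfolding has_mderiv_def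
proof (intro allI)
  fix i j
  define c where "c = (\<lambda>k. mpow M k $ i $ j / fact k)"
  have s: "(\<lambda>k. c k * z ^ k) sums (mexp (cscale z M) $ i $ j)" for z
    using bounded_linear.sums[OF bounded_linear_entry[of i j] mexp_sums[of z M]]
    by (simp add: c_def mult_ac)
  have "((\<lambda>z. \<Sum>k. c k * z ^ k) has_field_derivative (\<Sum>k. diffs c k * w ^ k)) (at w)"
    by (rule termdiffs_strong_converges_everywhere) (use s in \<open>blast intro: sums_summable\<close>)
  moreover have "(\<Sum>k. c k * z ^ k) = mexp (cscale z M) $ i $ j" for z
    using s sums_unique by metis
  moreover have "(\<Sum>k. diffs c k * w ^ k) = (mexp (cscale w M) ** M) $ i $ j"
  proof -
    have "(\<lambda>k. cscale (w ^ k / fact k) (mpow M k) ** M) sums (mexp (cscale w M) ** M)"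
      by (rule bounded_linear.sums[OF bounded_bilinear.bounded_linear_left[OF
          bounded_bilinear_matrix_mult] mexp_sums])
    from bounded_linear.sums[OF bounded_linear_entry[of i j] this]
    have "(\<lambda>k. w ^ k / fact k * mpow M (Suc k) $ i $ j) sums ((mexp (cscale w M) ** M) $ i $ j)"
      by simp
    moreover have "w ^ k / fact k * mpow M (Suc k) $ i $ j = diffs c k * w ^ k" for k
      by (simp add: diffs_def c_def field_simps del: mpow.simps of_nat_Suc)
    ultimately show ?thesis by (simp add: sums_iff)
  qed
  ultimately show "((\<lambda>w. mexp (cscale w M) $ i $ j) has_field_derivative
      (mexp (cscale w M) ** M) $ i $ j) (at w)" by simp
qed

text \<open>
  If \<open>F' = F M\<close>, then \<open>F w ** mexp (- w M)\<close> has derivative zero and equals \<open>I\<close> at \<open>0\<close>. The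
  same holds for \<open>mexp (w M)\<close> in place of \<open>F\<close>, so both are the inverse of \<open>mexp (- w M)\<close>.
\<close>

lemma mexp_unique_ode:
  assumes F: "\<And>w. has_mderiv F (F w ** M) w" and F0: "F 0 = mat 1"
  shows "F w = mexp (cscale w M)"
proof -
  define E where "E = (\<lambda>w. mexp (cscale w M))"
  have E: "has_mderiv E (E w ** M) w" for w unfolding E_def by (rule has_mderiv_mexp)
  have E0: "E 0 = mat 1" by (simp add: E_def mexp_0)
  have com: "E w ** M = M ** E w" for w
    using mcommute_mexp[OF mcommute_cscale[OF mcommute_refl], of M w]
    by (simp add: E_def mcommute_def)
  have neg: "has_mderiv (\<lambda>w. E (- w)) (- (E (- w) ** M)) w" for w
    using has_mderiv_chain[OF E DERIV_minus[OF DERIV_ident], of w]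
    by (simp add: cscale_minus_one)
  have *: "H w ** E (- w) = mat 1" if H: "\<And>w. has_mderiv H (H w ** M) w" "H 0 = mat 1" for H w
  proof -
    have "has_mderiv (\<lambda>w. H w ** E (- w)) 0 w" for w
      using has_mderiv_mult[OF H(1)[of w] neg[of w]]
      by (simp add: matrix_mult_uminus com matrix_mul_assoc)
    from has_mderiv_zero_const[OF this, of w] show ?thesis by (simp add: H(2) E0)
  qed
  have "F w ** E (- w) = E w ** E (- w)" using *[OF F F0] *[OF E E0] by simp
  moreover have "invertible (E (- w))" using *[OF E E0] by (rule invertibleI)
  ultimately have "F w = E w" by (rule cancel_invertible_right)
  thus ?thesis by (simp add: E_def)
qed

text \<open>
  The function \<open>exp (- w) mexp (w (M + I))\<close> solves \<open>F' = F M\<close> with \<open>F 0 = I\<close>; uniqueness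
  replaces the multiplication of two exponential series.
\<close>

lemma mpowr_plus_one:
  assumes "x \<noteq> 0"
  shows "mpowr x (M + mat 1) = cscale x (mpowr x M)"
proof -
  define E where "E = (\<lambda>w. mexp (cscale w (M + mat 1)))"
  define F where "F = (\<lambda>w. cscale (exp (- w)) (E w))"
  have "has_mderiv F (cscale (- exp (- w)) (E w) + cscale (exp (- w)) (E w ** (M + mat 1))) w" for w
    unfolding F_def E_def
    by (intro has_mderiv_cscale has_mderiv_mexp) (auto intro!: derivative_eq_intros)
  moreover have "cscale (- exp (- w)) (E w) + cscale (exp (- w)) (E w ** (M + mat 1)) = F w ** M" for w
    by (simp add: F_def matrix_add_ldistrib cscale_add_right vec_eq_iff)
  ultimately have "has_mderiv F (F w ** M) w" for w by simp
  moreover have "F 0 = mat 1" by (simp add: F_def E_def mexp_0)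
  ultimately have "F (Ln x) = mexp (cscale (Ln x) M)" by (rule mexp_unique_ode)
  hence "cscale x (F (Ln x)) = cscale x (mpowr x M)" by (simp add: mpowr_def)
  moreover have "cscale x (F (Ln x)) = mpowr x (M + mat 1)"
    using assms by (simp add: F_def E_def mpowr_def exp_minus)
  ultimately show ?thesis by simp
qed

lemma has_mderiv_mpowr:
  assumes "x \<notin> \<real>\<^sub>\<le>\<^sub>0"
  shows "has_mderiv (\<lambda>x. mpowr x M) (cscale (1 / x) (mpowr x M ** M)) x"
  unfolding mpowr_def using has_mderiv_chain[OF has_mderiv_mexp has_field_derivative_Ln[OF assms]]
  by (simp add: divide_inverse)

lemma mcommute_mpowr: "mcommute N M \<Longrightarrow> mcommute N (mpowr x M)"
  unfolding mpowr_def by (intro mcommute_mexp mcommute_cscale)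

lemma linear_transpose: "linear (transpose :: complex^'d^'d \<Rightarrow> _)"
  by (rule linearI) (simp_all add: transpose_add transpose_scalar)

lemma bounded_linear_transpose: "bounded_linear (transpose :: complex^'d^'d \<Rightarrow> _)"
  using linear_transpose by (simp add: linear_conv_bounded_linear)

lemma transpose_mpowr: "transpose (mpowr x M) = mpowr x (transpose M)"
proof -
  have pow: "transpose (mpow M k) = mpow (transpose M) k" for k
  proof (induction k)
    case (Suc k)
    have "mcommute M (mpow M k)"
      by (induction k) (simp_all add: mcommute_mat mcommute_mult mcommute_refl)
    hence "transpose (mpow M (Suc k)) = transpose (M ** mpow M k)" by (simp add: mcommute_def)
    thus ?case by (simp add: matrix_transpose_mul Suc)
  qed simp
  have "(\<lambda>k. cscale (Ln x ^ k / fact k) (mpow (transpose M) k)) sums transpose (mpowr x M)"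
    using bounded_linear.sums[OF bounded_linear_transpose mexp_sums[of "Ln x" M]]
    by (simp add: pow mpowr_def)
  thus ?thesis using mexp_sums[of "Ln x" "transpose M"] sums_unique2 unfolding mpowr_def by blast
qed


section \<open>Double power series with matrix coefficients\<close>

text \<open>
  For \<open>X, Y \<ge> 0\<close> this is absolute convergence of \<open>\<Sum> C\<^sub>m\<^sub>n x\<^sup>m y\<^sup>n\<close> at every point with
  \<open>\<bar>x\<bar> = X\<close> and \<open>\<bar>y\<bar> = Y\<close>.
\<close>

definition abs_conv :: "(nat \<times> nat \<Rightarrow> complex^'d^'d) \<Rightarrow> real \<Rightarrow> real \<Rightarrow> bool" where
  "abs_conv C X Y \<longleftrightarrow> (\<lambda>(m, n). norm (C (m, n)) * X ^ m * Y ^ n) summable_on UNIV"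

text \<open>
  The union of all open bidiscs on whose closure the series converges absolutely. The two strict
  inequalities leave the room needed for majorants and for the loss caused by polynomial weights.
\<close>

definition conv_dom :: "(nat \<times> nat \<Rightarrow> complex^'d^'d) \<Rightarrow> (complex \<times> complex) set" where
  "conv_dom C = {(x, y). \<exists>X Y. norm x < X \<and> norm y < Y \<and> abs_conv C X Y}"

definition dps :: "(nat \<times> nat \<Rightarrow> complex^'d^'d) \<Rightarrow> complex \<Rightarrow> complex \<Rightarrow> complex^'d^'d" where
  "dps C x y = (\<Sum>\<^sub>\<infinity>(m, n)\<in>UNIV. cscale (x ^ m * y ^ n) (C (m, n)))"

lemma abs_conv_mono:
  assumes "abs_conv C X Y" "0 \<le> X'" "X' \<le> X" "0 \<le> Y'" "Y' \<le> Y"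
  shows "abs_conv C X' Y'"
  using assms(1) unfolding abs_conv_def
  by (rule summable_on_comparison_test)
    (use assms in \<open>auto intro!: mult_mono power_mono\<close>)

lemma abs_conv_iff_norm_summable:
  "abs_conv C (norm x) (norm y) \<longleftrightarrow>
     (\<lambda>(m, n). norm (cscale (x ^ m * y ^ n) (C (m, n)))) summable_on UNIV"
  unfolding abs_conv_def
  by (intro summable_on_cong) (auto simp: norm_cscale norm_mult norm_power mult_ac)

lemma dps_has_sum:
  assumes "(x, y) \<in> conv_dom C"
  shows "((\<lambda>(m, n). cscale (x ^ m * y ^ n) (C (m, n))) has_sum dps C x y) UNIV"
proof -
  from assms obtain X Y where "norm x < X" "norm y < Y" "abs_conv C X Y"
    by (auto simp: conv_dom_def)
  hence "abs_conv C (norm x) (norm y)" by (auto intro: abs_conv_mono)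
  hence "(\<lambda>p. norm ((\<lambda>(m, n). cscale (x ^ m * y ^ n) (C (m, n))) p)) summable_on UNIV"
    by (simp add: abs_conv_iff_norm_summable case_prod_unfold)
  thus ?thesis unfolding dps_def
    by (intro has_sum_infsum) (rule Infinite_Sum.abs_summable_summable)
qed

lemma open_conv_dom: "open (conv_dom C)"
proof -
  have "conv_dom C = (\<Union>(X, Y)\<in>{(X, Y). abs_conv C X Y}. ball 0 X \<times> ball 0 Y)"
    by (fastforce simp: conv_dom_def)
  thus ?thesis by (auto intro!: open_Times)
qed

lemma ex_larger_norm:
  fixes x :: complex assumes "d \<ge> 0"
  shows "\<exists>x'. norm x' = norm x + d \<and> dist x x' = d"
proof (cases "x = 0")
  case True
  thus ?thesis using assms by (intro exI[of _ "of_real d"]) simp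
next
  case False
  have "x + of_real d * sgn x = of_real (norm x + d) * sgn x"
    using False by (simp add: sgn_div_norm scaleR_conv_of_real field_simps)
  hence "norm (x + of_real d * sgn x) = norm x + d"
    using False assms by (simp add: norm_mult norm_sgn del: of_real_add)
  thus ?thesis using False assms
    by (intro exI[of _ "x + of_real d * sgn x"]) (simp add: dist_norm norm_mult norm_sgn)
qed

text \<open>
  Around an interior point of the set of absolute convergence there is a point of that set both of
  whose coordinates have larger modulus. Since absolute convergence depends on the moduli only and
  is inherited by smaller ones, such a point makes a whole bidisc converge.
\<close>

lemma interior_abs_conv_eq_conv_dom:
  "interior {(x, y). (\<lambda>(m, n). norm (cscale (x ^ m * y ^ n) (C (m, n)))) summable_on UNIV} =
     conv_dom C" (is "interior ?S = _")
proof
  have S: "?S = {(x, y). abs_conv C (norm x) (norm y)}"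
    by (simp add: abs_conv_iff_norm_summable)
  show "conv_dom C \<subseteq> interior ?S"
    unfolding S by (rule interior_maximal[OF _ open_conv_dom])
      (force simp: conv_dom_def intro: abs_conv_mono)
  show "interior ?S \<subseteq> conv_dom C"
  proof
    fix p assume "p \<in> interior ?S"
    obtain x y where p: "p = (x, y)" by (cases p)
    obtain e where e: "e > 0" "ball (x, y) e \<subseteq> ?S"
      using \<open>p \<in> interior ?S\<close> unfolding p mem_interior by blast
    obtain x' y' where x': "norm x' = norm x + e / 3" "dist x x' = e / 3"
      and y': "norm y' = norm y + e / 3" "dist y y' = e / 3"
      using ex_larger_norm[of "e / 3"] e(1) by (metis divide_nonneg_nonneg less_imp_le zero_le_numeral)
    have "dist (x, y) (x', y') \<le> dist x x' + dist y y'"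
      unfolding dist_Pair_Pair by (intro sqrt_sum_squares_le_sum) auto
    hence "(x', y') \<in> ball (x, y) e" using x' y' e(1) by simp
    hence "abs_conv C (norm x') (norm y')" using e(2) unfolding S by auto
    moreover have "norm x < norm x'" "norm y < norm y'" using x' y' e(1) by auto
    ultimately show "p \<in> conv_dom C" unfolding conv_dom_def p by auto
  qed
qed

lemma Suc_times_power_bounded:
  fixes r R :: real
  assumes "0 \<le> r" "r < R"
  shows "\<exists>K. \<forall>m. real (Suc m) * r ^ m \<le> K * R ^ m"
proof -
  define q where "q = r / R"
  have q: "0 \<le> q" "q < 1" using assms by (auto simp: q_def)
  have "(\<lambda>n. real n * q ^ n) \<longlonglongrightarrow> 0"
    using powser_times_n_limit_0[of q] q by simp
  hence "Bseq (\<lambda>n. real n * q ^ n)" by (meson convergentI convergent_imp_Bseq)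
  then obtain K where K: "\<And>n. norm (real n * q ^ n) \<le> K" by (auto simp: Bseq_def)
  have "real (Suc m) * r ^ m \<le> (K + 1) * R ^ m" for m
  proof -
    have "real (Suc m) * q ^ m \<le> K + 1"
      using K[of m] power_le_one[of q m] q by (auto simp: algebra_simps)
    hence "real (Suc m) * q ^ m * R ^ m \<le> (K + 1) * R ^ m"
      using assms by (intro mult_right_mono) auto
    moreover have "q ^ m * R ^ m = r ^ m"
      using assms by (simp add: q_def flip: power_mult_distrib)
    ultimately show ?thesis by (simp add: mult.assoc)
  qed
  thus ?thesis by blast
qed

text \<open>
  Shrinking the radii slightly gains a geometric factor in each variable, which absorbs the weight
  \<open>(m + 1) (n + 1)\<close>.
\<close>

lemma conv_dom_weighted:
  assumes "(x, y) \<in> conv_dom C"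
  obtains X Y where "norm x < X" "norm y < Y"
    "(\<lambda>(m, n). real (Suc m) * real (Suc n) * (norm (C (m, n)) * X ^ m * Y ^ n)) summable_on UNIV"
proof -
  from assms obtain X0 Y0 where 0: "norm x < X0" "norm y < Y0" "abs_conv C X0 Y0"
    by (auto simp: conv_dom_def)
  define X Y where "X = (norm x + X0) / 2" and "Y = (norm y + Y0) / 2"
  have X: "norm x < X" "X < X0" "0 \<le> X" and Y: "norm y < Y" "Y < Y0" "0 \<le> Y"
    using 0 le_less_trans[OF norm_ge_zero 0(1)] le_less_trans[OF norm_ge_zero 0(2)]
    by (simp_all add: X_def Y_def)
  obtain K where K: "\<And>m. real (Suc m) * X ^ m \<le> K * X0 ^ m"
    using Suc_times_power_bounded[OF X(3,2)] by blast
  obtain L where L: "\<And>n. real (Suc n) * Y ^ n \<le> L * Y0 ^ n"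
    using Suc_times_power_bounded[OF Y(3,2)] by blast
  have "(\<lambda>p. (K * L) * (\<lambda>(m, n). norm (C (m, n)) * X0 ^ m * Y0 ^ n) p) summable_on UNIV"
    using 0(3) unfolding abs_conv_def by (rule summable_on_cmult_right)
  hence "(\<lambda>(m, n). real (Suc m) * real (Suc n) * (norm (C (m, n)) * X ^ m * Y ^ n)) summable_on UNIV"
  proof (rule summable_on_comparison_test, goal_cases)
    case (1 p)
    obtain m n where p: "p = (m, n)" by (cases p)
    have "(real (Suc m) * X ^ m) * (real (Suc n) * Y ^ n) \<le> (K * X0 ^ m) * (L * Y0 ^ n)"
      using X Y by (intro mult_mono K L order_trans[OF _ K]) auto
    from mult_left_mono[OF this norm_ge_zero[of "C (m, n)"]]
    show ?case by (simp add: p mult_ac)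
  qed (use X Y in \<open>auto intro!: mult_nonneg_nonneg\<close>)
  with X Y show ?thesis using that by blast
qed

text \<open>
  This and the next lemma compare domains of convergence: they do not shrink when coefficients grow
  by a polynomial weight, nor under an index shift with such a weight. They apply to the
  coefficients of \<open>G\<^sub>3\<close> before and after a shift of the parameters.
\<close>

lemma conv_dom_mono_weight:
  assumes le: "\<And>m n. norm (C' (m, n)) \<le> K * (real (Suc m) * real (Suc n) * norm (C (m, n)))"
  shows "conv_dom C \<subseteq> conv_dom C'"
proof
  fix p assume "p \<in> conv_dom C"
  obtain x y where p: "p = (x, y)" by (cases p)
  obtain X Y where XY: "norm x < X" "norm y < Y"
    "(\<lambda>(m, n). real (Suc m) * real (Suc n) * (norm (C (m, n)) * X ^ m * Y ^ n)) summable_on UNIV"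
    using conv_dom_weighted \<open>p \<in> conv_dom C\<close> unfolding p by blast
  have pos: "0 \<le> X" "0 \<le> Y" 
    using le_less_trans[OF norm_ge_zero XY(1)] le_less_trans[OF norm_ge_zero XY(2)] by auto
  have "(\<lambda>p. K * (\<lambda>(m, n). real (Suc m) * real (Suc n) * (norm (C (m, n)) * X ^ m * Y ^ n)) p)
      summable_on UNIV" using XY(3) by (rule summable_on_cmult_right)
  hence "abs_conv C' X Y" unfolding abs_conv_def
  proof (rule summable_on_comparison_test, goal_cases)
    case (1 p)
    obtain m n where p: "p = (m, n)" by (cases p)
    show ?case using mult_right_mono[OF le[of m n], of "X ^ m * Y ^ n"] pos by (simp add: p mult_ac)
  qed (use pos in auto)
  thus "p \<in> conv_dom C'" using XY(1,2) by (auto simp: conv_dom_def p)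
qed

lemma conv_dom_mono_shift:
  assumes K: "K \<ge> 0" and
    le: "\<And>m n. norm (C' (m, n)) \<le> K * (real (Suc m) * norm (C (Suc m, n)))"
  shows "conv_dom C \<subseteq> conv_dom C'"
proof
  fix p assume "p \<in> conv_dom C"
  obtain x y where p: "p = (x, y)" by (cases p)
  obtain X Y where XY: "norm x < X" "norm y < Y" and
    sum: "(\<lambda>(m, n). real (Suc m) * real (Suc n) * (norm (C (m, n)) * X ^ m * Y ^ n)) summable_on UNIV"
      (is "?w summable_on UNIV")
    using conv_dom_weighted \<open>p \<in> conv_dom C\<close> unfolding p by blast
  have pos: "0 < X" "0 < Y" 
    using le_less_trans[OF norm_ge_zero XY(1)] le_less_trans[OF norm_ge_zero XY(2)] by auto
  define h :: "nat \<times> nat \<Rightarrow> nat \<times> nat" where "h = (\<lambda>(m, n). (Suc m, n))"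
  have "inj h" by (auto simp: inj_on_def h_def)
  have "?w summable_on range h" using sum by (rule summable_on_subset_banach) simp
  hence "(?w \<circ> h) summable_on UNIV" by (simp add: summable_on_reindex \<open>inj h\<close>)
  hence "(\<lambda>p. K / X * (?w \<circ> h) p) summable_on UNIV" by (rule summable_on_cmult_right)
  hence "abs_conv C' X Y" unfolding abs_conv_def
  proof (rule summable_on_comparison_test, goal_cases)
    case (1 p)
    obtain m n where p: "p = (m, n)" by (cases p)
    have "norm (C' (m, n)) * X ^ m * Y ^ n
        \<le> K * (real (Suc m) * norm (C (Suc m, n))) * X ^ m * Y ^ n"
      using le pos by (intro mult_right_mono) auto
    also have "\<dots> = (K * real (Suc m)) * (norm (C (Suc m, n)) * X ^ m * Y ^ n)" by simp
    also have "\<dots> \<le> (K * (real (Suc (Suc m)) * real (Suc n))) * (norm (C (Suc m, n)) * X ^ m * Y ^ n)"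
    proof -
      have "real (Suc m) * 1 \<le> real (Suc (Suc m)) * real (Suc n)" by (intro mult_mono) auto
      thus ?thesis using K pos by (intro mult_right_mono mult_left_mono) auto
    qed
    also have "\<dots> = K / X * (real (Suc (Suc m)) * real (Suc n) *
        (norm (C (Suc m, n)) * X ^ Suc m * Y ^ n))" using pos by simp
    finally show ?case by (simp only: p h_def o_def prod.case)
  qed (use pos in auto)
  thus "p \<in> conv_dom C'" using XY by (auto simp: conv_dom_def p)
qed

lemma has_sum_matrixI:
  fixes f :: "'a \<Rightarrow> complex^'d^'d"
  assumes "\<And>i j. ((\<lambda>p. f p $ i $ j) has_sum D $ i $ j) S"
  shows "(f has_sum D) S"
  using assms unfolding has_sum_def by (auto intro!: vec_tendstoI)

text \<open>
  A double power series with holomorphic functions substituted for both variables may be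
  differentiated term by term. Near \<open>z\<close> the terms are dominated by the summable numbers
  \<open>\<bar>C\<^sub>m\<^sub>n\<bar> X\<^sup>m Y\<^sup>n\<close>, so the partial sums over finite index sets converge uniformly, and
  derivatives of holomorphic functions follow uniform limits. The derivative of the sum is thus
  summed over the unordered index set, with no appeal to the summability of the derivatives
  beforehand. The substitutions \<open>(x, y)\<close> and \<open>(x\<^sup>2, y / x)\<close> are both of this form.
\<close>

lemma dps_has_mderiv:
  assumes U: "open U" "z \<in> U" and u: "u holomorphic_on U" and v: "v holomorphic_on U"
    and dom: "(u z, v z) \<in> conv_dom C"
    and d: "\<And>m n. ((\<lambda>w. u w ^ m * v w ^ n) has_field_derivative d m n) (at z)"
  shows "\<exists>D. has_mderiv (\<lambda>w. dps C (u w) (v w)) D z \<and>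
             ((\<lambda>(m, n). cscale (d m n) (C (m, n))) has_sum D) UNIV"
proof -
  from dom obtain X Y where XY: "norm (u z) < X" "norm (v z) < Y" "abs_conv C X Y"
    by (auto simp: conv_dom_def)
  define V where "V = (U \<inter> u -` ball 0 X) \<inter> (U \<inter> v -` ball 0 Y)"
  have "open V" unfolding V_def using u v U
    by (intro open_Int continuous_open_preimage holomorphic_on_imp_continuous_on) auto
  moreover have "z \<in> V" using XY U by (auto simp: V_def)
  ultimately obtain r where r: "r > 0" "cball z r \<subseteq> V" using open_contains_cball by blast
  have "\<exists>c. ((\<lambda>w. dps C (u w) (v w) $ i $ j) has_field_derivative c) (at z) \<and>
      ((\<lambda>(m, n). d m n * C (m, n) $ i $ j) has_sum c) UNIV" for i j
  proof -
    define f where "f = (\<lambda>(m, n) w. u w ^ m * v w ^ n * C (m, n) $ i $ j)"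
    define b where "b = (\<lambda>(m, n). norm (C (m, n)) * X ^ m * Y ^ n)"
    have b: "norm (f p w) \<le> b p" if "w \<in> cball z r" for p w
    proof -
      obtain m n where p: "p = (m, n)" by (cases p)
      have w: "norm (u w) \<le> X" "norm (v w) \<le> Y" using that r by (auto simp: V_def)
      have "norm (C (m, n) $ i $ j) \<le> norm (C (m, n))"
        using Finite_Cartesian_Product.norm_nth_le[of "C (m, n)" i] Finite_Cartesian_Product.norm_nth_le[of "C (m, n) $ i" j] by linarith
      hence "norm (u w) ^ m * norm (v w) ^ n * norm (C (m, n) $ i $ j)
          \<le> X ^ m * Y ^ n * norm (C (m, n))"
        using w order_trans[OF norm_ge_zero w(1)] order_trans[OF norm_ge_zero w(2)]
        by (intro mult_mono power_mono) auto
      thus ?thesis by (simp add: p f_def b_def norm_mult norm_power mult_ac)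
    qed
    have "b summable_on UNIV" using XY(3) by (simp add: abs_conv_def b_def)
    with b have ulim: "uniform_limit (cball z r) (\<lambda>F w. \<Sum>p\<in>F. f p w)
        (\<lambda>w. \<Sum>\<^sub>\<infinity>p\<in>UNIV. f p w) (finite_subsets_at_top UNIV)"
      by (intro Weierstrass_m_test_general) auto
    have "f p holomorphic_on U" for p
      unfolding f_def using u v by (cases p) (auto intro!: holomorphic_intros)
    moreover have "cball z r \<subseteq> U" using r(2) by (auto simp: V_def)
    ultimately have f': "(f p has_field_derivative deriv (f p) w) (at w)" if "w \<in> cball z r" for p w
      using that by (intro holomorphic_derivI[OF _ U(1)]) auto
    have "eventually (\<lambda>F. continuous_on (cball z r) (\<lambda>w. \<Sum>p\<in>F. f p w) \<and> (\<forall>w\<in>ball z r.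
        ((\<lambda>w. \<Sum>p\<in>F. f p w) has_field_derivative (\<Sum>p\<in>F. deriv (f p) w)) (at w)))
        (finite_subsets_at_top UNIV)"
    proof (intro always_eventually allI)
      fix F
      have "((\<lambda>w. \<Sum>p\<in>F. f p w) has_field_derivative (\<Sum>p\<in>F. deriv (f p) w)) (at w)"
        if "w \<in> cball z r" for w using f' that by (intro DERIV_sum) auto
      moreover from this have "continuous_on (cball z r) (\<lambda>w. \<Sum>p\<in>F. f p w)"
        by (intro continuous_at_imp_continuous_on) (blast intro: DERIV_isCont)
      ultimately show "continuous_on (cball z r) (\<lambda>w. \<Sum>p\<in>F. f p w) \<and> (\<forall>w\<in>ball z r.
        ((\<lambda>w. \<Sum>p\<in>F. f p w) has_field_derivative (\<Sum>p\<in>F. deriv (f p) w)) (at w))" by auto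
    qed
    from has_complex_derivative_uniform_limit[OF this ulim finite_subsets_at_top_neq_bot r(1)]
    obtain g' where g': "\<And>w. w \<in> ball z r \<Longrightarrow>
        ((\<lambda>w. \<Sum>\<^sub>\<infinity>p\<in>UNIV. f p w) has_field_derivative g' w) (at w) \<and>
        ((\<lambda>F. \<Sum>p\<in>F. deriv (f p) w) \<longlongrightarrow> g' w) (finite_subsets_at_top UNIV)"
      by blast
    have eq: "(\<Sum>\<^sub>\<infinity>p\<in>UNIV. f p w) = dps C (u w) (v w) $ i $ j" if "w \<in> ball z r" for w
    proof (rule infsumI)
      have "w \<in> V" using that r(2) by auto
      hence "(u w, v w) \<in> conv_dom C" using XY(3) by (auto simp: V_def conv_dom_def)
      from has_sum_bounded_linear[OF bounded_linear_entry[of i j] dps_has_sum[OF this]]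
      show "((\<lambda>p. f p w) has_sum dps C (u w) (v w) $ i $ j) UNIV"
        by (simp add: f_def case_prod_unfold)
    qed
    have "z \<in> ball z r" using r by simp
    note g'z = g'[OF this]
    have "((\<lambda>w. dps C (u w) (v w) $ i $ j) has_field_derivative g' z) (at z)"
      by (rule has_field_derivative_transform_within_open[of _ _ _ "ball z r", OF conjunct1[OF g'z]])
        (use r eq in auto)
    moreover have "deriv (f (m, n)) z = d m n * C (m, n) $ i $ j" for m n
      unfolding f_def by (auto intro!: DERIV_imp_deriv DERIV_cmult_right d)
    hence "(\<lambda>(m, n). d m n * C (m, n) $ i $ j) = (\<lambda>p. deriv (f p) z)" by auto
    hence "((\<lambda>(m, n). d m n * C (m, n) $ i $ j) has_sum g' z) UNIV"
      using conjunct2[OF g'z] by (simp add: has_sum_def)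
    ultimately show ?thesis by blast
  qed
  hence "\<exists>c. \<forall>i j. ((\<lambda>w. dps C (u w) (v w) $ i $ j) has_field_derivative c i j) (at z) \<and>
      ((\<lambda>(m, n). d m n * C (m, n) $ i $ j) has_sum c i j) UNIV"
    by (intro choice allI) blast
  then obtain c where c: "\<And>i j. ((\<lambda>w. dps C (u w) (v w) $ i $ j) has_field_derivative c i j) (at z)"
      "\<And>i j. ((\<lambda>(m, n). d m n * C (m, n) $ i $ j) has_sum c i j) UNIV" by blast
  have "has_mderiv (\<lambda>w. dps C (u w) (v w)) (\<chi> i j. c i j) z" using c(1) by (simp add: has_mderiv_def)
  moreover have "((\<lambda>(m, n). cscale (d m n) (C (m, n))) has_sum (\<chi> i j. c i j)) UNIV"
    by (rule has_sum_matrixI) (use c(2) in \<open>simp add: case_prod_unfold\<close>)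
  ultimately show ?thesis by blast
qed


section \<open>The Horn matrix function as a double power series\<close>

definition G3_coeff :: "complex^'d^'d \<Rightarrow> complex^'d^'d \<Rightarrow> nat \<times> nat \<Rightarrow> complex^'d^'d" where
  "G3_coeff A A' = (\<lambda>(m, n). cscale (1 / (fact m * fact n))
     (mpoch_int A (2 * int n - int m) ** mpoch_int A' (2 * int m - int n)))"

lemma G3_term_eq:
  "G3_term A A' x y = (\<lambda>(m, n). cscale (x ^ m * y ^ n) (G3_coeff A A' (m, n)))"
  by (simp add: G3_term_def G3_coeff_def case_prod_unfold)

lemma G3_eq_dps: "G3 A A' x y = dps (G3_coeff A A') x y"
  unfolding G3_def dps_def G3_term_eq ..

lemma G3_dom_eq: "G3_dom A A' = conv_dom (G3_coeff A A')"
proof -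
  have "G3_dom A A' = interior {(x, y). (\<lambda>(m, n).
      norm (cscale (x ^ m * y ^ n) (G3_coeff A A' (m, n)))) summable_on UNIV}"
    unfolding G3_dom_def G3_term_eq by (simp add: case_prod_unfold)
  thus ?thesis by (simp only: interior_abs_conv_eq_conv_dom)
qed

lemma open_G3_dom: "open (G3_dom A A')"
  by (simp add: G3_dom_eq open_conv_dom)

lemma bounded_linear_two_sided:
  fixes P Q :: "complex^'d^'d"
  shows "bounded_linear (\<lambda>M :: complex^'d^'d. P ** M ** Q)"
  by (rule bounded_linear_compose[OF
        bounded_bilinear.bounded_linear_left[OF bounded_bilinear_matrix_mult]
        bounded_bilinear.bounded_linear_right[OF bounded_bilinear_matrix_mult]])

lemma norm_two_sided_le:
  fixes P Q :: "complex^'d^'d"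
  shows "\<exists>K>0. \<forall>M. norm (P ** M ** Q) \<le> norm M * K"
  using bounded_linear.pos_bounded[OF bounded_linear_two_sided[of P Q]] by blast

lemma dps_two_sided:
  fixes P Q :: "complex^'d^'d"
  assumes "(x, y) \<in> conv_dom C"
  shows "((\<lambda>(m, n). cscale (x ^ m * y ^ n) (P ** C (m, n) ** Q)) has_sum (P ** dps C x y ** Q)) UNIV"
  using has_sum_bounded_linear[OF bounded_linear_two_sided dps_has_sum[OF assms], of P Q]
  by (simp add: case_prod_unfold)

subsection \<open>Differentiation in the first variable\<close>

lemma invertible_one_minus:
  assumes "mpoch_defined A" shows "invertible (mat 1 - A)"
  using assms[unfolded mpoch_defined_def, rule_format, of 1] by simp

text \<open>
  Replacing \<open>m\<close> by \<open>m + 1\<close> changes the indices \<open>2n - m\<close> and \<open>2m - n\<close> by \<open>-1\<close> and \<open>+2\<close>. This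
  lemma and the next rewrite the changed symbols with shifted parameters; the extra factors no longer
  depend on \<open>m\<close> and \<open>n\<close>. As \<open>A\<close> and \<open>A'\<close> need not commute, the factor from \<open>A\<close> has to be
  moved to the left end of the product and the factor from \<open>A'\<close> to the right end.
\<close>

lemma mpoch_int_minus_one:
  fixes A :: "complex^'d^'d"
  assumes A: "mpoch_defined A"
  shows "mpoch_int A (k - 1) = cscale (- 1) (matrix_inv (mat 1 - A) ** mpoch_int (A - mat 1) k)"
proof -
  have "mpoch_defined (A - mat 1)" using mpoch_defined_minus[OF A, of 1] by simp
  from mpoch_int_shift[OF this, of "k - 1"] A
  have *: "(A - mat 1) ** mpoch_int A (k - 1) = mpoch_int (A - mat 1) k" by simp
  have neg: "A - mat 1 = - (mat 1 - A)" by simp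
  note inv = invertible_one_minus[OF A]
  have "matrix_inv (mat 1 - A) ** mpoch_int (A - mat 1) k
      = matrix_inv (mat 1 - A) ** (- (mat 1 - A) ** mpoch_int A (k - 1))"
    unfolding * [symmetric] using neg by simp
  also have "\<dots> = - (matrix_inv (mat 1 - A) ** (mat 1 - A) ** mpoch_int A (k - 1))"
    by (simp only: matrix_mult_uminus matrix_mul_assoc)
  finally show ?thesis by (simp add: invertible_inv inv cscale_uminus_right)
qed

lemma mpoch_int_plus_two:
  fixes M :: "complex^'d^'d"
  assumes M2: "mpoch_defined (M + mat 2)"
  shows "mpoch_int M (k + 2) = mpoch_int (M + mat 2) k ** mpoch M 2" "invertible (mpoch M 2)"
proof -
  have e: "M + mat 2 = M + mat 1 + mat 1" by (simp add: plus_mat_mat)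
  have M: "mpoch_defined M" and M1: "mpoch_defined (M + mat 1)"
    using mpoch_defined_plus_mono[of M 2 0] mpoch_defined_plus_mono[of M 2 1] M2 by simp_all
  have "mpoch_int M (k + 1 + 1) = M ** ((M + mat 1) ** mpoch_int (M + mat 2) k)"
    using mpoch_int_shift[OF M M1, of "k + 1"] mpoch_int_shift[OF M1, of k] M2 by (simp add: e)
  also have "\<dots> = mpoch M 2 ** mpoch_int (M + mat 2) k"
    by (simp add: numeral_2_eq_2 matrix_mul_assoc)
  also have "\<dots> = mpoch_int (M + mat 2) k ** mpoch M 2"
  proof -
    have "mcommute (mpoch M 2) (M + mat 2)"
      by (rule mcommute_sym, rule mcommute_shift_mpoch)
    from mcommute_mpoch_int[OF this M2, of k] show ?thesis by (simp add: mcommute_def)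
  qed
  finally show "mpoch_int M (k + 2) = mpoch_int (M + mat 2) k ** mpoch M 2"
    by (simp add: add.assoc)
  have "invertible M" "invertible (M + mat 1)"
    using mpoch_defined_factor[OF M1, of 0] mpoch_defined_factor[OF M2, of 0]
    by (simp_all add: e add_ac)
  thus "invertible (mpoch M 2)" by (simp add: numeral_2_eq_2 invertible_mult)
qed

lemma G3_coeff_Suc:
  assumes A: "mpoch_defined A" and A': "mpoch_defined (A' + mat 2)"
  shows "cscale (of_nat (Suc m)) (G3_coeff A A' (Suc m, n)) =
    cscale (- 1) (matrix_inv (mat 1 - A) ** G3_coeff (A - mat 1) (A' + mat 2) (m, n) ** mpoch A' 2)"
proof -
  have i: "2 * int n - int (Suc m) = 2 * int n - int m - 1"
    "2 * int (Suc m) - int n = 2 * int m - int n + 2" by simp_all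
  show ?thesis
    unfolding G3_coeff_def prod.case i mpoch_int_minus_one[OF A] mpoch_int_plus_two(1)[OF A']
    by (simp add: matrix_mul_assoc del: of_nat_Suc)
qed

text \<open>
  The relation between the coefficients can be solved for the shifted ones, because
  \<open>(A')\<^sub>2\<close> is invertible when \<open>(A' + 2I)\<^sub>k\<close> makes sense for all integers \<open>k\<close>. Hence the
  shifted series converges wherever the original one does. Without this inclusion the right-hand
  side could be a meaningless sum, and the formula could not be iterated.
\<close>

lemma G3_dom_x_shift1:
  assumes A: "mpoch_defined A" and A': "mpoch_defined (A' + mat 2)"
  shows "G3_dom A A' \<subseteq> G3_dom (A - mat 1) (A' + mat 2)"
proof -
  define C where "C = G3_coeff A A'"
  define C' where "C' = G3_coeff (A - mat 1) (A' + mat 2)"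
  note inv = invertible_one_minus[OF A] mpoch_int_plus_two(2)[OF A']
  obtain K where K: "K > 0"
    "\<And>M. norm ((mat 1 - A) ** M ** matrix_inv (mpoch A' 2)) \<le> norm M * K"
    using norm_two_sided_le by blast
  have "C' (m, n) = cscale (- of_nat (Suc m)) ((mat 1 - A) ** C (Suc m, n) ** matrix_inv (mpoch A' 2))"
    for m n
  proof -
    have "(mat 1 - A) ** cscale (of_nat (Suc m)) (C (Suc m, n)) ** matrix_inv (mpoch A' 2) =
      cscale (- 1) (((mat 1 - A) ** matrix_inv (mat 1 - A)) ** C' (m, n) **
        (mpoch A' 2 ** matrix_inv (mpoch A' 2)))"
      unfolding C_def C'_def G3_coeff_Suc[OF A A'] by (simp add: matrix_mul_assoc)
    from arg_cong[OF this, of "cscale (- 1)"] show ?thesis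
      by (simp add: invertible_inv inv del: of_nat_Suc)
  qed
  hence "norm (C' (m, n)) \<le> K * (real (Suc m) * norm (C (Suc m, n)))" for m n
    using mult_left_mono[OF K(2)[of "C (Suc m, n)"], of "real (Suc m)"]
    by (simp add: norm_cscale mult_ac del: of_nat_Suc)
  with K(1) show ?thesis unfolding G3_dom_eq C_def[symmetric] C'_def[symmetric]
    by (intro conv_dom_mono_shift[where K = K]) auto
qed

lemma has_mderiv_G3_x:
  assumes A: "mpoch_defined A" and A': "mpoch_defined (A' + mat 2)" and xy: "(x, y) \<in> G3_dom A A'"
  shows "has_mderiv (\<lambda>x. G3 A A' x y) (cscale (- 1)
    (matrix_inv (mat 1 - A) ** G3 (A - mat 1) (A' + mat 2) x y ** mpoch A' 2)) x"
proof -
  let ?C = "G3_coeff A A'" and ?C' = "G3_coeff (A - mat 1) (A' + mat 2)"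
  define d where "d = (\<lambda>m n. of_nat m * x ^ (m - 1) * y ^ n)"
  have "((\<lambda>w. w ^ m * y ^ n) has_field_derivative d m n) (at x)" for m n
    unfolding d_def by (auto intro!: derivative_eq_intros)
  with xy have "\<exists>D. has_mderiv (\<lambda>w. dps ?C w y) D x \<and>
      ((\<lambda>(m, n). cscale (d m n) (?C (m, n))) has_sum D) UNIV"
    by (intro dps_has_mderiv[where U = UNIV and u = "\<lambda>w. w" and v = "\<lambda>w. y"])
      (auto simp: G3_dom_eq intro: holomorphic_intros)
  then obtain D where D: "has_mderiv (\<lambda>w. dps ?C w y) D x"
      "((\<lambda>(m, n). cscale (d m n) (?C (m, n))) has_sum D) UNIV" (is "(?g has_sum D) UNIV") by blast
  \<comment> \<open>The terms with \<open>m = 0\<close> vanish; the others are reindexed by \<open>m \<mapsto> m + 1\<close>.\<close>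
  define h :: "nat \<times> nat \<Rightarrow> nat \<times> nat" where "h = (\<lambda>(m, n). (Suc m, n))"
  have h: "inj h" by (auto simp: inj_on_def h_def)
  have "?g (m, n) = 0" if "(m, n) \<notin> range h" for m n
  proof -
    have "m = 0" using that by (cases m) (auto simp: h_def image_iff)
    thus ?thesis by (simp add: d_def)
  qed
  hence "(?g has_sum D) (range h)"
    using D(2) by (subst has_sum_cong_neutral[where T = UNIV and g = ?g]) auto
  hence 1: "((?g \<circ> h) has_sum D) UNIV" using h by (simp add: has_sum_reindex)
  have "(?g \<circ> h) (m, n) =
      cscale (x ^ m * y ^ n) ((- matrix_inv (mat 1 - A)) ** ?C' (m, n) ** mpoch A' 2)" for m n
  proof -
    have "(?g \<circ> h) (m, n) = cscale (x ^ m * y ^ n) (cscale (of_nat (Suc m)) (?C (Suc m, n)))"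
      by (simp add: h_def d_def mult_ac del: of_nat_Suc)
    thus ?thesis unfolding G3_coeff_Suc[OF A A'] by (simp add: matrix_mult_uminus cscale_minus_one)
  qed
  hence 2: "?g \<circ> h = (\<lambda>(m, n). cscale (x ^ m * y ^ n)
      ((- matrix_inv (mat 1 - A)) ** ?C' (m, n) ** mpoch A' 2))" by auto
  have "(x, y) \<in> conv_dom ?C'"
    using G3_dom_x_shift1[OF A A'] xy unfolding G3_dom_eq by blast
  from dps_two_sided[OF this, of "- matrix_inv (mat 1 - A)" "mpoch A' 2"]
  have 3: "((\<lambda>(m, n). cscale (x ^ m * y ^ n) ((- matrix_inv (mat 1 - A)) ** ?C' (m, n) ** mpoch A' 2))
    has_sum ((- matrix_inv (mat 1 - A)) ** dps ?C' x y ** mpoch A' 2)) UNIV" .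
  have "D = (- matrix_inv (mat 1 - A)) ** dps ?C' x y ** mpoch A' 2"
    by (rule has_sum_unique[OF 1[unfolded 2] 3])
  with D(1) show ?thesis by (simp add: G3_eq_dps matrix_mult_uminus cscale_minus_one)
qed

lemma mpoch_defined_even_shift:
  assumes "mpoch_defined (A' + mat (of_nat (2 * Suc r)))"
  shows "mpoch_defined (A' + mat (of_nat (2 * r)))"
    "mpoch_defined (A' + mat (of_nat (2 * r)) + mat 2)"
    "A' + mat (of_nat (2 * Suc r)) = A' + mat (of_nat (2 * r)) + mat 2"
proof -
  show e: "A' + mat (of_nat (2 * Suc r)) = A' + mat (of_nat (2 * r)) + mat 2"
    by (simp add: mat_plus_mat[symmetric] add_ac)
  show "mpoch_defined (A' + mat (of_nat (2 * r)) + mat 2)" using assms unfolding e .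
  show "mpoch_defined (A' + mat (of_nat (2 * r)))"
    using assms by (rule mpoch_defined_plus_mono) simp
qed

lemma minus_mat_Suc:
  fixes A :: "complex^'d^'d"
  shows "A - mat (of_nat (Suc r)) = A - mat (of_nat r) - mat 1"
  by (simp add: minus_mat_mat add.commute)

lemma G3_dom_x_shift:
  assumes A: "mpoch_defined A" and A': "mpoch_defined (A' + mat (of_nat (2 * r)))"
  shows "G3_dom A A' \<subseteq> G3_dom (A - mat (of_nat r)) (A' + mat (of_nat (2 * r)))"
  using A'
proof (induction r)
  case (Suc r)
  note s = mpoch_defined_even_shift[OF Suc.prems]
  show ?case
    using Suc.IH[OF s(1)] G3_dom_x_shift1[OF mpoch_defined_minus[OF A] s(2)]
    unfolding s(3) minus_mat_Suc by blast
qed simp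

lemma open_slice_x: "open {x. (x, y) \<in> G3_dom A A'}"
proof -
  have "{x. (x, y) \<in> G3_dom A A'} = (\<lambda>x. (x, y)) -` G3_dom A A'" by auto
  thus ?thesis by (auto intro!: continuous_open_vimage open_G3_dom continuous_intros)
qed

lemma mholomorphic_G3_x:
  assumes "mpoch_defined A" "mpoch_defined (A' + mat 2)"
  shows "mholomorphic_on (\<lambda>x. G3 A A' x y) {x. (x, y) \<in> G3_dom A A'}"
  by (rule mholomorphic_onI) (use has_mderiv_G3_x[OF assms] in auto)

text \<open>
  Iteration of the case \<open>r = 1\<close>. The constants collect on the outside: the left ones to
  \<open>(I - A)\<^sub>r\<^sup>-\<^sup>1\<close>, the right ones to \<open>(A')\<^bsub>2r\<^esub>\<close>, since polynomials in one matrix commute.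
\<close>

theorem higher_mderiv_G3_x:
  assumes A: "mpoch_defined A" and A': "mpoch_defined (A' + mat (of_nat (2 * r)))"
    and xy: "(x, y) \<in> G3_dom A A'"
  shows "(mderiv ^^ r) (\<lambda>x. G3 A A' x y) x = cscale ((-1) ^ r)
    (matrix_inv (mpoch (mat 1 - A) r) ** G3 (A - mat (of_nat r)) (A' + mat (of_nat (2 * r))) x y
       ** mpoch A' (2 * r))"
  using A' xy
proof (induction r arbitrary: x)
  case 0
  have "matrix_inv (mat 1) = (mat 1 :: complex^'a^'a)" by (rule matrix_inv_eqI) simp
  thus ?case by simp
next
  case (Suc r)
  note s = mpoch_defined_even_shift[OF Suc.prems(1)]
  let ?B = "A - mat (of_nat r)" and ?B' = "A' + mat (of_nat (2 * r))"
  let ?P = "mpoch (mat 1 - A) r"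
  have inv: "invertible ?P" "invertible (mat 1 - ?B)"
    using A invertible_one_minus[OF mpoch_defined_minus[OF A, of r]]
    by (simp_all add: mpoch_defined_def)
  have "(mderiv ^^ Suc r) (\<lambda>x. G3 A A' x y) x = mderiv (\<lambda>x.
      cscale ((-1) ^ r) (matrix_inv ?P) ** G3 ?B ?B' x y ** mpoch A' (2 * r)) x"
    unfolding funpow.simps o_def
    by (rule mderiv_cong[OF open_slice_x[of y A A']]) (use Suc.IH[OF s(1)] Suc.prems(2) in auto)
  also have "\<dots> = cscale ((-1) ^ r) (matrix_inv ?P) ** cscale (- 1)
      (matrix_inv (mat 1 - ?B) ** G3 (?B - mat 1) (?B' + mat 2) x y ** mpoch ?B' 2) ** mpoch A' (2 * r)"
    by (intro mderiv_eqI has_mderiv_mult_const has_mderiv_G3_x mpoch_defined_minus A s(2))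
      (use G3_dom_x_shift[OF A s(1)] Suc.prems(2) in blast)
  also have "\<dots> = cscale ((-1) ^ Suc r) ((matrix_inv ?P ** matrix_inv (mat 1 - ?B)) **
      G3 (?B - mat 1) (?B' + mat 2) x y ** (mpoch ?B' 2 ** mpoch A' (2 * r)))"
    by (simp add: matrix_mul_assoc)
  also have "matrix_inv ?P ** matrix_inv (mat 1 - ?B) = matrix_inv (mpoch (mat 1 - A) (Suc r))"
  proof -
    have "mat 1 - ?B = mat 1 - A + mat (of_nat r)" by simp
    thus ?thesis
      using matrix_inv_mult[OF inv(2,1)] mcommute_shift_mpoch[of "mat 1 - A" "of_nat r" r]
      by (simp only: mcommute_def mpoch.simps)
  qed
  also have "mpoch ?B' 2 ** mpoch A' (2 * r) = mpoch A' (2 * Suc r)"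
  proof -
    have "mcommute (mpoch A' (2 * r)) (mpoch ?B' 2)"
      by (intro mcommute_mpoch mcommute_sym[OF mcommute_shift_mpoch])
    thus ?thesis using mpoch_add[of A' "2 * r" 2] by (simp add: mcommute_def add.commute)
  qed
  finally show ?case unfolding s(3) minus_mat_Suc .
qed


subsection \<open>The operator \<open>x\<^sup>2 d/dx\<close>\<close>

lemma mpoch_int_plus_one_mult:
  fixes M :: "complex^'d^'d"
  assumes M1: "mpoch_defined (M + mat 1)"
  shows "mpoch_int (M + mat 1) k ** M = mpoch_int M k ** (M + mat (of_int k))" "invertible M"
proof -
  have M: "mpoch_defined M" using mpoch_defined_plus_mono[of M 1 0] M1 by simp
  have "mcommute M (mpoch_int (M + mat 1) k)"
    using M1 by (intro mcommute_mpoch_int mcommute_add mcommute_refl mcommute_mat)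
  thus "mpoch_int (M + mat 1) k ** M = mpoch_int M k ** (M + mat (of_int k))"
    using mpoch_int_shift[OF M M1, of k] mpoch_int_plus_one[OF M, of k] by (simp add: mcommute_def)
  show "invertible M" using mpoch_defined_factor[OF M1, of 0] by simp
qed

text \<open>
  Multiplication of the \<open>(m, n)\<close> coefficient by \<open>A' + (2m - n) I\<close> raises the parameter \<open>A'\<close>
  by \<open>I\<close>. The number \<open>2m - n\<close> is the exponent of \<open>x\<close> in \<open>(x\<^sup>2)\<^sup>m (y / x)\<^sup>n\<close>, so differentiating
  such a term times \<open>x\<^bsup>A'\<^esup>\<close> produces exactly this factor.
\<close>

lemma G3_coeff_plus_one:
  fixes A A' :: "complex^'d^'d"
  assumes "mpoch_defined (A' + mat 1)"
  shows "G3_coeff A (A' + mat 1) (m, n) ** A' =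
    G3_coeff A A' (m, n) ** A' + cscale (2 * of_nat m - of_nat n) (G3_coeff A A' (m, n))"
proof -
  have "G3_coeff A (A' + mat 1) (m, n) ** A' =
      G3_coeff A A' (m, n) ** (A' + mat (of_int (2 * int m - int n)))"
    using mpoch_int_plus_one_mult(1)[OF assms, of "2 * int m - int n"]
    by (simp add: G3_coeff_def flip: matrix_mul_assoc)
  thus ?thesis by (simp add: matrix_add_ldistrib mat_mult_eq_cscale)
qed

lemma G3_dom_plus_one:
  fixes A A' :: "complex^'d^'d"
  assumes A': "mpoch_defined (A' + mat 1)"
  shows "G3_dom A A' \<subseteq> G3_dom A (A' + mat 1)"
proof -
  define C where "C = G3_coeff A A'"
  define C' where "C' = G3_coeff A (A' + mat 1)"
  note inv = mpoch_int_plus_one_mult(2)[OF A']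
  obtain K where K: "K > 0" "\<And>M :: complex^'d^'d. norm (mat 1 ** M ** matrix_inv A') \<le> norm M * K"
    using norm_two_sided_le[of "mat 1" "matrix_inv A'"] by blast
  have "norm (C' (m, n)) \<le> (1 + 2 * K) * (real (Suc m) * real (Suc n) * norm (C (m, n)))" for m n
  proof -
    have "C' (m, n) = C' (m, n) ** A' ** matrix_inv A'"
      by (simp add: invertible_inv inv flip: matrix_mul_assoc)
    also have "\<dots> = C (m, n) ** A' ** matrix_inv A' +
        cscale (2 * of_nat m - of_nat n) (C (m, n)) ** matrix_inv A'"
      unfolding C_def C'_def G3_coeff_plus_one[OF A'] by (rule matrix_add_rdistrib)
    also have "\<dots> = C (m, n) + cscale (2 * of_nat m - of_nat n) (mat 1 ** C (m, n) ** matrix_inv A')"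
      by (simp add: invertible_inv inv flip: matrix_mul_assoc)
    finally have "norm (C' (m, n)) \<le> norm (C (m, n)) +
        norm (2 * of_nat m - of_nat n :: complex) * norm (mat 1 ** C (m, n) ** matrix_inv A')"
      by (simp only: norm_triangle_ineq flip: norm_cscale)
    also have "\<dots> \<le> norm (C (m, n)) + (2 * (real (Suc m) * real (Suc n))) * (norm (C (m, n)) * K)"
    proof -
      have "norm (2 * of_nat m - of_nat n :: complex) \<le> 2 * real m + real n"
        using norm_triangle_ineq4[of "2 * of_nat m :: complex" "of_nat n"] by (simp add: norm_mult)
      also have "\<dots> \<le> 2 * (real (Suc m) * real (Suc n))" by (simp add: algebra_simps)
      finally show ?thesis using K by (intro add_left_mono mult_mono) auto
    qed
    also have "\<dots> \<le> (real (Suc m) * real (Suc n)) * norm (C (m, n)) +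
        (2 * (real (Suc m) * real (Suc n))) * (norm (C (m, n)) * K)"
      using mult_mono[of 1 "real (Suc m)" 1 "real (Suc n)"]
        mult_right_mono[of 1 "real (Suc m) * real (Suc n)" "norm (C (m, n))"] by simp
    finally show ?thesis by (simp only: ring_distribs mult_1_left mult_ac)
  qed
  thus ?thesis unfolding G3_dom_eq C_def[symmetric] C'_def[symmetric] by (rule conv_dom_mono_weight)
qed

lemma DERIV_square_power_times_quotient_power:
  fixes x y :: complex
  assumes "x \<noteq> 0"
  shows "((\<lambda>w. (w\<^sup>2) ^ m * (y / w) ^ n) has_field_derivative
    (2 * of_nat m - of_nat n) / x * ((x\<^sup>2) ^ m * (y / x) ^ n)) (at x)"
proof -
  have "((\<lambda>w. (w\<^sup>2) ^ m) has_field_derivative 2 * of_nat m / x * (x\<^sup>2) ^ m) (at x)"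
  proof -
    have "((\<lambda>w. w\<^sup>2) has_field_derivative 2 * x) (at x)"
      by (auto intro!: derivative_eq_intros)
    from DERIV_power[OF this, of m] show ?thesis
      by (rule DERIV_cong) (use assms in \<open>cases m; simp add: power2_eq_square algebra_simps add_divide_distrib\<close>)
  qed
  moreover have "((\<lambda>w. (y / w) ^ n) has_field_derivative - of_nat n / x * (y / x) ^ n) (at x)"
  proof -
    have "((\<lambda>w. y / w) has_field_derivative - (y / x) / x) (at x)"
      using assms by (auto intro!: derivative_eq_intros)
    from DERIV_power[OF this, of n] show ?thesis
      by (rule DERIV_cong) (cases n; simp add: algebra_simps add_divide_distrib diff_divide_distrib)
  qed
  ultimately have "((\<lambda>w. (w\<^sup>2) ^ m * (y / w) ^ n) has_field_derivative
      2 * of_nat m / x * (x\<^sup>2) ^ m * (y / x) ^ n + - of_nat n / x * (y / x) ^ n * (x\<^sup>2) ^ m) (at x)"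
    by (rule DERIV_mult)
  thus ?thesis by (simp add: algebra_simps diff_divide_distrib)
qed

text \<open>
  By the product rule, \<open>x\<close> times the derivative of \<open>G x\<^bsup>A'\<^esup>\<close> is
  \<open>(x G' + G A') x\<^bsup>A'\<^esup>\<close>. The bracket is summed term by term to the function with parameter
  \<open>A' + I\<close>, times \<open>A'\<close>.
\<close>

lemma has_mderiv_G3_mpowr:
  fixes A A' :: "complex^'d^'d"
  assumes A': "mpoch_defined (A' + mat 1)"
    and x: "x \<notin> \<real>\<^sub>\<le>\<^sub>0" and xy: "(x\<^sup>2, y / x) \<in> G3_dom A A'"
  shows "has_mderiv (\<lambda>x. G3 A A' (x\<^sup>2) (y / x) ** mpowr x A') (cscale (1 / x\<^sup>2)
    (G3 A (A' + mat 1) (x\<^sup>2) (y / x) ** mpowr x (A' + mat 1) ** A')) x"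
proof -
  have x0: "x \<noteq> 0" using x by auto
  let ?C = "G3_coeff A A'" and ?C' = "G3_coeff A (A' + mat 1)"
  define d where "d = (\<lambda>m n. (2 * of_nat m - of_nat n) / x * ((x\<^sup>2) ^ m * (y / x) ^ n))"
  have "\<exists>D. has_mderiv (\<lambda>w. dps ?C (w\<^sup>2) (y / w)) D x \<and>
      ((\<lambda>(m, n). cscale (d m n) (?C (m, n))) has_sum D) UNIV"
    using xy x0 DERIV_square_power_times_quotient_power[OF x0, of _ y]
    by (intro dps_has_mderiv[where U = "- {0}"])
      (auto simp: G3_dom_eq d_def intro!: holomorphic_intros)
  then obtain D where D: "has_mderiv (\<lambda>w. dps ?C (w\<^sup>2) (y / w)) D x"
      "((\<lambda>(m, n). cscale (d m n) (?C (m, n))) has_sum D) UNIV" (is "(?g has_sum D) UNIV") by blast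
  let ?G = "dps ?C (x\<^sup>2) (y / x)" and ?G' = "dps ?C' (x\<^sup>2) (y / x)"
  have dom: "(x\<^sup>2, y / x) \<in> conv_dom ?C" "(x\<^sup>2, y / x) \<in> conv_dom ?C'"
    using xy G3_dom_plus_one[OF A'] unfolding G3_dom_eq by auto
  have "((\<lambda>p. mat x ** ?g p ** mat 1) has_sum (mat x ** D ** mat 1)) UNIV"
    by (rule has_sum_bounded_linear[OF bounded_linear_two_sided D(2)])
  from has_sum_add[OF this dps_two_sided[OF dom(1), of "mat 1" A']]
  have "((\<lambda>(m, n). cscale ((x\<^sup>2) ^ m * (y / x) ^ n)
      (mat 1 ** ?C' (m, n) ** A')) has_sum (cscale x D + ?G ** A')) UNIV"
    using x0 by (simp add: case_prod_unfold mat_mult_eq_cscale G3_coeff_plus_one[OF A'] d_def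
        cscale_add_right add.commute mult_ac)
  hence G': "cscale x D + ?G ** A' = ?G' ** A'"
    using has_sum_unique dps_two_sided[OF dom(2), of "mat 1" A'] by fastforce
  have com: "A' ** mpowr x A' = mpowr x A' ** A'"
    using mcommute_mpowr[OF mcommute_refl] by (simp add: mcommute_def)
  have "has_mderiv (\<lambda>x. dps ?C (x\<^sup>2) (y / x) ** mpowr x A')
      (D ** mpowr x A' + ?G ** cscale (1 / x) (mpowr x A' ** A')) x"
    by (rule has_mderiv_mult[OF D(1) has_mderiv_mpowr[OF x]])
  also have "D ** mpowr x A' + ?G ** cscale (1 / x) (mpowr x A' ** A') =
      cscale (1 / x) ((cscale x D + ?G ** A') ** mpowr x A')"
    using x0 by (simp add: matrix_add_rdistrib cscale_add_right com flip: matrix_mul_assoc)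
  also have "\<dots> = cscale (1 / x\<^sup>2) (?G' ** mpowr x (A' + mat 1) ** A')"
    using x0 unfolding G' by (simp add: mpowr_plus_one com power2_eq_square flip: matrix_mul_assoc)
  finally show ?thesis by (simp add: G3_eq_dps)
qed

lemma sq_deriv_G3_mpowr:
  assumes "mpoch_defined (A' + mat 1)" "x \<notin> \<real>\<^sub>\<le>\<^sub>0" "(x\<^sup>2, y / x) \<in> G3_dom A A'"
  shows "sq_deriv (\<lambda>x. G3 A A' (x\<^sup>2) (y / x) ** mpowr x A' ** Q) x =
    G3 A (A' + mat 1) (x\<^sup>2) (y / x) ** mpowr x (A' + mat 1) ** A' ** Q"
proof -
  have "x \<noteq> 0" using assms(2) by auto
  thus ?thesis
    using mderiv_eqI[OF has_mderiv_mult_const[OF has_mderiv_G3_mpowr[OF assms], of "mat 1" Q]]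
    by (simp add: sq_deriv_def)
qed

lemma mholomorphic_G3_mpowr:
  assumes "mpoch_defined (A' + mat 1)"
  shows "mholomorphic_on (\<lambda>x. G3 A A' (x\<^sup>2) (y / x) ** mpowr x A')
    {x. x \<notin> \<real>\<^sub>\<le>\<^sub>0 \<and> (x\<^sup>2, y / x) \<in> G3_dom A A'}"
  by (rule mholomorphic_onI) (use has_mderiv_G3_mpowr[OF assms] in auto)

lemma open_slice_sq: "open {x. x \<notin> \<real>\<^sub>\<le>\<^sub>0 \<and> (x\<^sup>2, y / x) \<in> G3_dom A A'}"
proof -
  have "{x. x \<notin> \<real>\<^sub>\<le>\<^sub>0 \<and> (x\<^sup>2, y / x) \<in> G3_dom A A'} =
      (- \<real>\<^sub>\<le>\<^sub>0) \<inter> (\<lambda>x. (x\<^sup>2, y / x)) -` G3_dom A A'" by auto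
  moreover have "continuous_on (- \<real>\<^sub>\<le>\<^sub>0) (\<lambda>x. (x\<^sup>2, y / x))"
    by (intro continuous_intros) auto
  ultimately show ?thesis
    by (auto intro!: continuous_open_preimage open_G3_dom open_Compl closed_nonpos_Reals_complex)
qed

lemma G3_dom_plus:
  assumes "mpoch_defined (A' + mat (of_nat r))"
  shows "G3_dom A A' \<subseteq> G3_dom A (A' + mat (of_nat r))"
  using assms
proof (induction r)
  case (Suc r)
  have e: "A' + mat (of_nat (Suc r)) = A' + mat (of_nat r) + mat 1"
    by (simp add: add_ac flip: mat_plus_mat)
  have "mpoch_defined (A' + mat (of_nat r))"
    using Suc.prems by (rule mpoch_defined_plus_mono) simp
  from Suc.IH[OF this] show ?case using G3_dom_plus_one Suc.prems unfolding e by blast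
qed simp

text \<open>
  Iteration of the case \<open>r = 1\<close>: the factors \<open>A' + (r - 1) I, \<dots>, A'\<close> split off at the right
  end multiply to \<open>(A')\<^sub>r\<close>.
\<close>

theorem higher_sq_deriv_G3_mpowr:
  assumes "mpoch_defined (A' + mat (of_nat r))"
    and "x \<notin> \<real>\<^sub>\<le>\<^sub>0" "(x\<^sup>2, y / x) \<in> G3_dom A A'"
  shows "(sq_deriv ^^ r) (\<lambda>x. G3 A A' (x\<^sup>2) (y / x) ** mpowr x A') x =
    G3 A (A' + mat (of_nat r)) (x\<^sup>2) (y / x) ** mpowr x (A' + mat (of_nat r)) ** mpoch A' r"
  using assms
proof (induction r arbitrary: x)
  case (Suc r)
  let ?B = "A' + mat (of_nat r)"
  have e: "A' + mat (of_nat (Suc r)) = ?B + mat 1"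
    by (simp add: add_ac flip: mat_plus_mat)
  have B: "mpoch_defined ?B"
    using Suc.prems(1) by (rule mpoch_defined_plus_mono) simp
  have "mderiv ((sq_deriv ^^ r) (\<lambda>x. G3 A A' (x\<^sup>2) (y / x) ** mpowr x A')) x =
      mderiv (\<lambda>x. G3 A ?B (x\<^sup>2) (y / x) ** mpowr x ?B ** mpoch A' r) x"
    by (rule mderiv_cong[OF open_slice_sq[of y A A']]) (use Suc.IH[OF B] Suc.prems(2,3) in auto)
  hence "(sq_deriv ^^ Suc r) (\<lambda>x. G3 A A' (x\<^sup>2) (y / x) ** mpowr x A') x =
      sq_deriv (\<lambda>x. G3 A ?B (x\<^sup>2) (y / x) ** mpowr x ?B ** mpoch A' r) x"
    by (simp add: sq_deriv_def)
  also have "\<dots> = G3 A (?B + mat 1) (x\<^sup>2) (y / x) ** mpowr x (?B + mat 1) ** ?B ** mpoch A' r"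
    using Suc.prems G3_dom_plus[OF B] unfolding e by (intro sq_deriv_G3_mpowr) auto
  also have "\<dots> = G3 A (?B + mat 1) (x\<^sup>2) (y / x) ** mpowr x (?B + mat 1) ** mpoch A' (Suc r)"
    using mcommute_shift_mpoch[of A' "of_nat r" r]
    by (simp add: mcommute_def flip: matrix_mul_assoc)
  finally show ?case unfolding e .
qed simp

section \<open>Symmetry under transposition\<close>

lemma norm_transpose: "norm (transpose M) = norm (M :: complex^'d^'d)"
proof -
  have "norm N = sqrt (\<Sum>i\<in>UNIV. \<Sum>j\<in>UNIV. (norm (N $ i $ j))\<^sup>2)" for N :: "complex^'d^'d"
    by (simp add: norm_vec_def L2_set_def sum_nonneg)
  thus ?thesis by (simp add: transpose_def) (rule sum.swap)
qed

text \<open>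
  Transposing reverses the product \<open>(A)\<^bsub>2n-m\<^esub> (A')\<^bsub>2m-n\<^esub>\<close>, which is undone by exchanging \<open>A\<close>
  with \<open>A'\<close> and \<open>m\<close> with \<open>n\<close>. So \<open>G\<^sub>3 (A, A'; x, y)\<close> is the transpose of
  \<open>G\<^sub>3 (A'\<^sup>T, A\<^sup>T; y, x)\<close>, on the same domain up to the exchange of the variables. The
  formulae in \<open>y\<close>, with all constants on the opposite side, are then the transposed formulae in
  \<open>x\<close>.
\<close>

lemma abs_conv_transpose:
  assumes "\<And>m n. C' (n, m) = transpose (C (m, n))"
  shows "abs_conv C' Y X \<longleftrightarrow> abs_conv C X Y"
proof -
  have "abs_conv C' Y X \<longleftrightarrow> (\<lambda>p. (\<lambda>(n, m). norm (C' (n, m)) * Y ^ n * X ^ m) (prod.swap p)) summable_on UNIV"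
    unfolding abs_conv_def by (rule summable_on_reindex_bij_betw[OF bij_swap, symmetric])
  also have "\<dots> \<longleftrightarrow> abs_conv C X Y"
    unfolding abs_conv_def by (intro summable_on_cong) (auto simp: assms norm_transpose)
  finally show ?thesis .
qed

lemma conv_dom_transpose:
  assumes "\<And>m n. C' (n, m) = transpose (C (m, n))"
  shows "(y, x) \<in> conv_dom C' \<longleftrightarrow> (x, y) \<in> conv_dom C"
  using abs_conv_transpose[of C' C, OF assms] by (auto simp: conv_dom_def)

lemma dps_transpose:
  assumes "\<And>m n. C' (n, m) = transpose (C (m, n))"
  shows "dps C' y x = transpose (dps C x y)"
proof -
  let ?f = "\<lambda>(m, n). cscale (x ^ m * y ^ n) (C (m, n))"
  have "dps C' y x = (\<Sum>\<^sub>\<infinity>p\<in>UNIV. (\<lambda>(n, m). cscale (y ^ n * x ^ m) (C' (n, m))) (prod.swap p))"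
    unfolding dps_def by (rule infsum_reindex_bij_betw[OF bij_swap, symmetric])
  also have "\<dots> = (\<Sum>\<^sub>\<infinity>p\<in>UNIV. transpose (?f p))"
    by (intro infsum_cong) (auto simp: assms mult.commute)
  also have "\<dots> = transpose (infsum ?f UNIV)"
    by (rule infsum_bounded_linear_strong[OF
          summable_on_bounded_linear_iff[where h' = transpose]])
      (auto simp: bounded_linear_transpose)
  finally show ?thesis by (simp add: dps_def)
qed

lemma G3_coeff_transpose:
  assumes "mpoch_defined A" "mpoch_defined A'"
  shows "G3_coeff (transpose A') (transpose A) (n, m) = transpose (G3_coeff A A' (m, n))"
  using assms by (simp add: G3_coeff_def matrix_transpose_mul transpose_mpoch_int mult.commute)

lemma G3_transpose:
  assumes "mpoch_defined A" "mpoch_defined A'"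
  shows "transpose (G3 (transpose A') (transpose A) y x) = G3 A A' x y"
proof -
  have "dps (G3_coeff (transpose A') (transpose A)) y x = transpose (dps (G3_coeff A A') x y)"
    by (rule dps_transpose) (rule G3_coeff_transpose[OF assms])
  thus ?thesis by (simp add: G3_eq_dps)
qed

lemma G3_dom_transpose:
  assumes "mpoch_defined A" "mpoch_defined A'"
  shows "(y, x) \<in> G3_dom (transpose A') (transpose A) \<longleftrightarrow> (x, y) \<in> G3_dom A A'"
  unfolding G3_dom_eq by (rule conv_dom_transpose) (rule G3_coeff_transpose[OF assms])

lemma mholomorphic_on_transpose:
  "mholomorphic_on f S \<Longrightarrow> mholomorphic_on (\<lambda>z. transpose (f z)) S"
  by (simp add: mholomorphic_on_def transpose_def)

lemma mderiv_transpose: "mderiv (\<lambda>z. transpose (f z)) = (\<lambda>z. transpose (mderiv f z))"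
  by (simp add: mderiv_def transpose_def vec_eq_iff fun_eq_iff)

lemma higher_mderiv_transpose:
  "(mderiv ^^ r) (\<lambda>z. transpose (f z)) = (\<lambda>z. transpose ((mderiv ^^ r) f z))"
  by (induction r) (simp_all add: mderiv_transpose)

lemma higher_sq_deriv_transpose:
  "(sq_deriv ^^ r) (\<lambda>z. transpose (f z)) = (\<lambda>z. transpose ((sq_deriv ^^ r) f z))"
  by (induction r) (simp_all add: sq_deriv_def mderiv_transpose)

lemma
  fixes M :: "complex^'d^'d"
  shows transpose_plus_mat: "transpose (M + mat c) = transpose M + mat c"
  and transpose_minus_mat: "transpose (M - mat c) = transpose M - mat c"
  by (simp_all add: transpose_add transpose_diff)

section \<open>The four differential formulae\<close>

theorem theorem4p3:
  fixes A A' :: "complex^'d^'d" and r :: nat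
  assumes "r \<ge> 1" and "mpoch_defined A" and "mpoch_defined A'"
  shows
    "(mpoch_defined (A - mat (of_nat r)) \<and> mpoch_defined (A' + mat (of_nat (2 * r))) \<longrightarrow>
       (\<forall>y. mholomorphic_on (\<lambda>x. G3 A A' x y) {x. (x, y) \<in> G3_dom A A'}) \<and>
       (\<forall>x y. (x, y) \<in> G3_dom A A' \<longrightarrow>
         (mderiv ^^ r) (\<lambda>x. G3 A A' x y) x =
           cscale ((-1) ^ r)
             (matrix_inv (mpoch (mat 1 - A) r)
                ** G3 (A - mat (of_nat r)) (A' + mat (of_nat (2 * r))) x y
                ** mpoch A' (2 * r))))
     \<and>
     (mpoch_defined (A + mat (of_nat (2 * r))) \<and> mpoch_defined (A' - mat (of_nat r)) \<longrightarrow>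
       (\<forall>x. mholomorphic_on (\<lambda>y. G3 A A' x y) {y. (x, y) \<in> G3_dom A A'}) \<and>
       (\<forall>x y. (x, y) \<in> G3_dom A A' \<longrightarrow>
         (mderiv ^^ r) (\<lambda>y. G3 A A' x y) y =
           cscale ((-1) ^ r)
             (mpoch A (2 * r)
                ** G3 (A + mat (of_nat (2 * r))) (A' - mat (of_nat r)) x y
                ** matrix_inv (mpoch (mat 1 - A') r))))
     \<and>
     (mpoch_defined (A' + mat (of_nat r)) \<longrightarrow>
       (\<forall>y. mholomorphic_on (\<lambda>x. G3 A A' (x\<^sup>2) (y / x) ** mpowr x A')
              {x. x \<notin> \<real>\<^sub>\<le>\<^sub>0 \<and> (x\<^sup>2, y / x) \<in> G3_dom A A'}) \<and>
       (\<forall>x y. x \<notin> \<real>\<^sub>\<le>\<^sub>0 \<and> (x\<^sup>2, y / x) \<in> G3_dom A A' \<longrightarrow>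
         (sq_deriv ^^ r) (\<lambda>x. G3 A A' (x\<^sup>2) (y / x) ** mpowr x A') x =
           G3 A (A' + mat (of_nat r)) (x\<^sup>2) (y / x)
             ** mpowr x (A' + mat (of_nat r)) ** mpoch A' r))
     \<and>
     (mpoch_defined (A + mat (of_nat r)) \<longrightarrow>
       (\<forall>x. mholomorphic_on (\<lambda>y. mpowr y A ** G3 A A' (x / y) (y\<^sup>2))
              {y. y \<notin> \<real>\<^sub>\<le>\<^sub>0 \<and> (x / y, y\<^sup>2) \<in> G3_dom A A'}) \<and>
       (\<forall>x y. y \<notin> \<real>\<^sub>\<le>\<^sub>0 \<and> (x / y, y\<^sup>2) \<in> G3_dom A A' \<longrightarrow>
         (sq_deriv ^^ r) (\<lambda>y. mpowr y A ** G3 A A' (x / y) (y\<^sup>2)) y =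
           mpowr y (A + mat (of_nat r)) ** mpoch A r
             ** G3 (A + mat (of_nat r)) A' (x / y) (y\<^sup>2)))"
proof (intro conjI impI allI)
  note def = assms(2,3)
  note tdef = mpoch_defined_transpose[of A, THEN iffD2, OF def(1)]
    mpoch_defined_transpose[of A', THEN iffD2, OF def(2)]
  have two: "mpoch_defined (M + mat 2)" if "mpoch_defined (M + mat (of_nat (2 * r)))"
    for M :: "complex^'d^'d"
    using mpoch_defined_plus_mono[OF that, of 2] assms(1) by simp
  have one: "mpoch_defined (M + mat 1)" if "mpoch_defined (M + mat (of_nat r))"
    for M :: "complex^'d^'d"
    using mpoch_defined_plus_mono[OF that, of 1] assms(1) by simp
  {
    assume d: "mpoch_defined (A - mat (of_nat r)) \<and> mpoch_defined (A' + mat (of_nat (2 * r)))"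
    show "mholomorphic_on (\<lambda>x. G3 A A' x y) {x. (x, y) \<in> G3_dom A A'}" for y
      using def two d by (intro mholomorphic_G3_x) auto
    show "(mderiv ^^ r) (\<lambda>x. G3 A A' x y) x = cscale ((-1) ^ r)
        (matrix_inv (mpoch (mat 1 - A) r) ** G3 (A - mat (of_nat r)) (A' + mat (of_nat (2 * r))) x y
          ** mpoch A' (2 * r))" if "(x, y) \<in> G3_dom A A'" for x y
      using def d that by (intro higher_mderiv_G3_x) auto
  }
  {
    assume d: "mpoch_defined (A + mat (of_nat (2 * r))) \<and> mpoch_defined (A' - mat (of_nat r))"
    hence t2: "mpoch_defined (transpose A + mat (of_nat (2 * r)))"
      using mpoch_defined_transpose[of "A + mat (of_nat (2 * r))"] by (simp add: transpose_plus_mat)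
    have eq: "(\<lambda>y. G3 A A' x y) = (\<lambda>y. transpose (G3 (transpose A') (transpose A) y x))" for x
      by (simp add: G3_transpose def)
    show "mholomorphic_on (\<lambda>y. G3 A A' x y) {y. (x, y) \<in> G3_dom A A'}" for x
      unfolding eq G3_dom_transpose[OF def, symmetric]
      by (intro mholomorphic_on_transpose mholomorphic_G3_x tdef two t2)
    show "(mderiv ^^ r) (\<lambda>y. G3 A A' x y) y = cscale ((-1) ^ r)
        (mpoch A (2 * r) ** G3 (A + mat (of_nat (2 * r))) (A' - mat (of_nat r)) x y
          ** matrix_inv (mpoch (mat 1 - A') r))" if "(x, y) \<in> G3_dom A A'" for x y
    proof -
      have "(y, x) \<in> G3_dom (transpose A') (transpose A)"
        using that by (simp add: G3_dom_transpose def)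
      note * = higher_mderiv_G3_x[OF tdef(2) t2 this]
      have "invertible (mpoch (mat 1 - A') r)" using def(2) by (simp add: mpoch_defined_def)
      hence inv: "transpose (matrix_inv (mpoch (mat 1 - transpose A') r)) =
          matrix_inv (mpoch (mat 1 - A') r)"
        using matrix_inv_transpose[of "mpoch (mat 1 - A') r"]
        by (simp add: transpose_mpoch transpose_diff)
      have G: "transpose (G3 (transpose A' - mat (of_nat r)) (transpose A + mat (of_nat (2 * r))) y x)
          = G3 (A + mat (of_nat (2 * r))) (A' - mat (of_nat r)) x y"
        using G3_transpose[of "A + mat (of_nat (2 * r))" "A' - mat (of_nat r)" y x] d
        by (simp add: transpose_plus_mat transpose_minus_mat)
      show ?thesis
        unfolding eq higher_mderiv_transpose *
        using G by (simp add: matrix_transpose_mul inv transpose_mpoch matrix_mul_assoc)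
    qed
  }
  {
    assume d: "mpoch_defined (A' + mat (of_nat r))"
    show "mholomorphic_on (\<lambda>x. G3 A A' (x\<^sup>2) (y / x) ** mpowr x A')
        {x. x \<notin> \<real>\<^sub>\<le>\<^sub>0 \<and> (x\<^sup>2, y / x) \<in> G3_dom A A'}" for y
      by (intro mholomorphic_G3_mpowr one d)
    show "(sq_deriv ^^ r) (\<lambda>x. G3 A A' (x\<^sup>2) (y / x) ** mpowr x A') x =
        G3 A (A' + mat (of_nat r)) (x\<^sup>2) (y / x) ** mpowr x (A' + mat (of_nat r)) ** mpoch A' r"
      if "x \<notin> \<real>\<^sub>\<le>\<^sub>0 \<and> (x\<^sup>2, y / x) \<in> G3_dom A A'" for x y
      using that d by (intro higher_sq_deriv_G3_mpowr) auto
  }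
  {
    assume d: "mpoch_defined (A + mat (of_nat r))"
    hence t: "mpoch_defined (transpose A + mat (of_nat r))"
      using mpoch_defined_transpose[of "A + mat (of_nat r)"] by (simp add: transpose_plus_mat)
    have eq: "(\<lambda>y. mpowr y A ** G3 A A' (x / y) (y\<^sup>2)) =
        (\<lambda>y. transpose (G3 (transpose A') (transpose A) (y\<^sup>2) (x / y) ** mpowr y (transpose A)))" for x
      by (simp add: matrix_transpose_mul G3_transpose transpose_mpowr def)
    show "mholomorphic_on (\<lambda>y. mpowr y A ** G3 A A' (x / y) (y\<^sup>2))
        {y. y \<notin> \<real>\<^sub>\<le>\<^sub>0 \<and> (x / y, y\<^sup>2) \<in> G3_dom A A'}" for x
      unfolding eq G3_dom_transpose[OF def, symmetric]
      by (intro mholomorphic_on_transpose mholomorphic_G3_mpowr one t)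
    show "(sq_deriv ^^ r) (\<lambda>y. mpowr y A ** G3 A A' (x / y) (y\<^sup>2)) y =
        mpowr y (A + mat (of_nat r)) ** mpoch A r ** G3 (A + mat (of_nat r)) A' (x / y) (y\<^sup>2)"
      if y: "y \<notin> \<real>\<^sub>\<le>\<^sub>0 \<and> (x / y, y\<^sup>2) \<in> G3_dom A A'" for x y
    proof -
      have "(y\<^sup>2, x / y) \<in> G3_dom (transpose A') (transpose A)"
        using y by (simp add: G3_dom_transpose def)
      note * = higher_sq_deriv_G3_mpowr[OF t _ this]
      have G: "transpose (G3 (transpose A') (transpose A + mat (of_nat r)) (y\<^sup>2) (x / y)) =
          G3 (A + mat (of_nat r)) A' (x / y) (y\<^sup>2)"
        using G3_transpose[of "A + mat (of_nat r)" A' "y\<^sup>2" "x / y"] d def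
        by (simp add: transpose_plus_mat)
      have com: "mcommute (mpoch A r) (mpowr y (A + mat (of_nat r)))"
        by (intro mcommute_mpowr mcommute_sym[OF mcommute_shift_mpoch])
      have "(sq_deriv ^^ r) (\<lambda>y. mpowr y A ** G3 A A' (x / y) (y\<^sup>2)) y =
          mpoch A r ** (mpowr y (A + mat (of_nat r)) ** G3 (A + mat (of_nat r)) A' (x / y) (y\<^sup>2))"
        unfolding eq higher_sq_deriv_transpose using y
        by (simp add: * matrix_transpose_mul G transpose_mpoch transpose_mpowr transpose_plus_mat)
      thus ?thesis using com by (simp add: mcommute_def matrix_mul_assoc)
    qed
  }
qed

end
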